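(* Let $k \geq 1$ be a real number, let $q$ be an even natural number, and write $\Lambda = 6 + 25 \log q$ and \[ s = 2^{5 + (1 + 120 \cdot 2^{\lceil 600 q k \Lambda \rceil})(\lceil \log k \rceil + 1)}. \] Then for every finite, non-empty set $A$ of integers, there exist pairwise disjoint sets $B, C$ such that $A = B \cup C$ and \[ E_{q/2}(B) \ll_{k,q} |B|^{q - q/5} \quad \text{and} \quad M_{s}(C) \ll_{s} |C|^{2s - k}. \]
   Context: For a natural number $t$ and a finite set $X$ of real numbers, the $t$-fold additive energy is $E_t(X) = |\{(x_1,\dots,x_{2t}) \in X^{2t} : x_1 + \dots + x_t = x_{t+1} + \dots + x_{2t}\}|$ and the $t$-fold multiplicative energy is $M_t(X) = |\{(x_1,\dots,x_{2t}) \in X^{2t} : x_1 \cdots x_t = x_{t+1} \cdots x_{2t}\}|$. The notation $X \ll_z Y$ means $|X| \leq C_z |Y|$ for a positive constant $C_z$ depending only on the parameter(s) $z$. *)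

theory Defs
  imports Complex_Main "HOL-Library.FuncSet"
begin

definition add_energy :: "nat \<Rightarrow> int set \<Rightarrow> nat" where
  "add_energy t X = card {x \<in> {0..<2*t} \<rightarrow>\<^sub>E X. (\<Sum>i<t. x i) = (\<Sum>i\<in>{t..<2*t}. x i)}"

definition mult_energy :: "nat \<Rightarrow> int set \<Rightarrow> nat" where
  "mult_energy t X = card {x \<in> {0..<2*t} \<rightarrow>\<^sub>E X. (\<Prod>i<t. x i) = (\<Prod>i\<in>{t..<2*t}. x i)}"

definition Lam :: "nat \<Rightarrow> real" where
  "Lam q = 6 + 25 * ln (real q)"

definition s_param :: "real \<Rightarrow> nat \<Rightarrow> nat" where
  "s_param k q = 2 ^ nat (5 + (1 + 120 * 2 ^ nat \<lceil>600 * real q * k * Lam q\<rceil>) * (\<lceil>ln k\<rceil> + 1))"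

end

theory Submission
  imports Defs "HOL-Computational_Algebra.Primes" "HOL-Analysis.Convex"
begin

text \<open>Let \<open>E\<close> denote the energy of a nonnegative function \<open>f\<close> on the positive integers, that is, the sum of
  \<open>f a f b f c f d\<close> over all \<open>a b = c d\<close>. By Young's inequality \<open>E \<le> m\<^sup>3\<close> with \<open>m = \<Sum>f\<^bsup>4/3\<^esup>\<close>. If \<open>E\<close> is not
  much smaller than \<open>m\<^sup>3\<close>, then a large part of the support has a small \<open>\<Lambda>\<^sub>q\<close> constant. This is shown by
  induction on the primes: the energy of \<open>f\<close> is at most the additive energy over \<open>\<int>\<close> of the fourth roots of
  the energies of the \<open>p\<close>-adic fibres, and since \<open>\<int>\<close> is torsion-free, Young's inequality is strict there
  unless one fibre dominates. Hence either one passes to a single fibre, at the cost of some mass, or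
  many fibres have a normalised energy larger by a constant factor; the gain then pays for one
  application of Chang's inequality, which bounds the \<open>\<Lambda>\<^sub>q\<close> constant of a union of fibres.

  If \<open>M\<^sub>s(A)\<close> is large and \<open>s = 2\<^sup>L\<close>, then among the \<open>L\<close> dyadic scales below \<open>s\<close> there is one at which the
  multiplicative representation function of \<open>A\<close> has almost maximal energy. The structured set found in its
  support has a dilate that contains almost all of \<open>A\<close>, up to a factor \<open>|A|\<^bsup>1/20\<^esup>\<close>. Removing such subsets
  greedily, and adding up their additive energies by Minkowski's inequality, yields \<open>B\<close>; what remains is \<open>C\<close>.\<close>

section \<open>Energies and Young's inequality\<close>

text \<open>The number of primes is unbounded, so no step of the induction may lose even a constant
  factor for free. This dictates the norm: with exponent 4/3, Young's inequality has constant 1 and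
  passes to fibres without loss, because the energy of a fibre relative to the whole is exactly
  \<open>(\<eta> * \<alpha>) ^ 3\<close>, with \<alpha> its relative mass and \<eta> its relative
  normalised energy. The induction therefore claims a subset whose mass is a positive power of the
  normalised energy and whose \<Lambda> constant is a negative power of it: mass may be given up
  only against a rise of the normalised energy, and Chang's factor \<open>(2 * h) ^ 2\<close> only
  against a rise by \<open>exp step_size\<close>. Since Young's inequality caps the normalised
  energy at 1, its initial value limits the total loss, however many primes occur. Writing f = r^3
  keeps the exponents integral. The number s enters only through L = log2 s: one doubling loses a
  factor K = |A|^(k/L) on average, and fixed powers of K have to stay below |A|^(1/20). For this L
  must exceed a large constant times k (1 + log q), which the given s exceeds by far.\<close>

text \<open>The inner product of the push-forwards of F along k and of G along l. Energies are of
  this form in two ways, pairing sums or pairing differences, so one Cauchy-Schwarz inequality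
  serves both.\<close>

definition ker_sum :: "('a \<Rightarrow> 'c) \<Rightarrow> ('a \<Rightarrow> real) \<Rightarrow> 'a set \<Rightarrow> ('b \<Rightarrow> 'c) \<Rightarrow> ('b \<Rightarrow> real) \<Rightarrow> 'b set \<Rightarrow> real" where
  "ker_sum k F X l G Y = (\<Sum>x\<in>X. \<Sum>y\<in>Y. if k x = l y then F x * G y else 0)"

lemma ker_sum_eq:
  assumes "finite X" "finite Y" "finite Z" "k ` X \<subseteq> Z"
  shows "ker_sum k F X l G Y = (\<Sum>z\<in>Z. (\<Sum>x\<in>{x\<in>X. k x = z}. F x) * (\<Sum>y\<in>{y\<in>Y. l y = z}. G y))"
proof -
  have "(\<Sum>z\<in>Z. (\<Sum>x\<in>{x\<in>X. k x = z}. F x) * (\<Sum>y\<in>{y\<in>Y. l y = z}. G y))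
      = (\<Sum>z\<in>Z. \<Sum>x\<in>{x\<in>X. k x = z}. F x * (\<Sum>y\<in>{y\<in>Y. l y = k x}. G y))"
    by (intro sum.cong refl) (simp add: sum_distrib_right)
  also have "\<dots> = (\<Sum>x\<in>X. F x * (\<Sum>y\<in>{y\<in>Y. l y = k x}. G y))"
    using assms by (intro sum.group) auto
  also have "\<dots> = ker_sum k F X l G Y"
    unfolding ker_sum_def using assms
    by (intro sum.cong refl) (auto simp: sum_distrib_left sum.inter_filter intro!: sum.cong)
  finally show ?thesis by simp
qed

lemma ker_sum_Cauchy_Schwarz:
  assumes "finite X" "finite Y"
  shows "(ker_sum k F X l G Y)\<^sup>2 \<le> ker_sum k F X k F X * ker_sum l G Y l G Y"
proof -
  define Z where "Z = k ` X \<union> l ` Y"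
  have Z: "finite Z" "k ` X \<subseteq> Z" "l ` Y \<subseteq> Z" using assms by (auto simp: Z_def)
  show ?thesis
    using Cauchy_Schwarz_ineq_sum[of "\<lambda>z. \<Sum>x\<in>{x\<in>X. k x = z}. F x" "\<lambda>z. \<Sum>y\<in>{y\<in>Y. l y = z}. G y" Z]
    by (simp add: ker_sum_eq[OF assms(1,2) Z(1,2)] ker_sum_eq[OF assms(1,1) Z(1,2)]
        ker_sum_eq[OF assms(2,2) Z(1,3)] power2_eq_square)
qed

text \<open>Values of \<phi> in an arbitrary abelian group let one theory cover both energies:
  \<open>id\<close> on the integers gives the additive one, and the logarithm turns a b = c d into
  an additive relation.\<close>

definition quad :: "('a \<Rightarrow> 'b::ab_group_add) \<Rightarrow> ('a \<Rightarrow> real) \<Rightarrow> 'a set \<Rightarrow> 'a set \<Rightarrow> 'a set \<Rightarrow> 'a set \<Rightarrow> real" where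
  "quad \<phi> f A B C D = (\<Sum>a\<in>A. \<Sum>b\<in>B. \<Sum>c\<in>C. \<Sum>d\<in>D.
     if \<phi> a + \<phi> b = \<phi> c + \<phi> d then f a * f b * f c * f d else 0)"

abbreviation energy :: "('a \<Rightarrow> 'b::ab_group_add) \<Rightarrow> ('a \<Rightarrow> real) \<Rightarrow> 'a set \<Rightarrow> real" where
  "energy \<phi> f A \<equiv> quad \<phi> f A A A A"

lemma quad_nonneg:
  assumes "\<And>a. a \<in> A \<union> B \<union> C \<union> D \<Longrightarrow> 0 \<le> f a"
  shows "0 \<le> quad \<phi> f A B C D"
  unfolding quad_def using assms by (intro sum_nonneg) auto

lemma quad_eq_ker_sum:
  "quad \<phi> f A B C D = ker_sum (\<lambda>(a,b). \<phi> a + \<phi> b) (\<lambda>(a,b). f a * f b) (A \<times> B)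
     (\<lambda>(c,d). \<phi> c + \<phi> d) (\<lambda>(c,d). f c * f d) (C \<times> D)"
  unfolding quad_def ker_sum_def
  by (simp add: sum.cartesian_product' mult.assoc cong: if_cong)

lemma quad_eq_ker_sum_diff:
  "quad \<phi> f A B C D = ker_sum (\<lambda>(a,c). \<phi> a - \<phi> c) (\<lambda>(a,c). f a * f c) (A \<times> C)
     (\<lambda>(d,b). \<phi> d - \<phi> b) (\<lambda>(d,b). f d * f b) (D \<times> B)"
proof -
  have "quad \<phi> f A B C D = (\<Sum>a\<in>A. \<Sum>c\<in>C. \<Sum>d\<in>D. \<Sum>b\<in>B.
     if \<phi> a + \<phi> b = \<phi> c + \<phi> d then f a * f b * f c * f d else 0)"
    unfolding quad_def
    by (rule sum.cong[OF refl], subst sum.swap, rule sum.cong[OF refl], rule sum.swap)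
  also have "\<dots> = ker_sum (\<lambda>(a,c). \<phi> a - \<phi> c) (\<lambda>(a,c). f a * f c) (A \<times> C)
     (\<lambda>(d,b). \<phi> d - \<phi> b) (\<lambda>(d,b). f d * f b) (D \<times> B)"
    unfolding ker_sum_def
    by (auto simp: sum.cartesian_product' algebra_simps intro!: sum.cong)
  finally show ?thesis .
qed

text \<open>Cauchy-Schwarz twice: pairing sums separates {A, B} from {C, D}, and then pairing
  differences in \<open>quad \<phi> f A B A B\<close> separates A from B.\<close>

lemma quad_le_prod_energy:
  assumes fin: "finite A" "finite B" "finite C" "finite D"
    and f: "\<And>a. a \<in> A \<union> B \<union> C \<union> D \<Longrightarrow> 0 \<le> f a"
  shows "quad \<phi> f A B C D ^ 4 \<le> energy \<phi> f A * energy \<phi> f B * energy \<phi> f C * energy \<phi> f D"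
proof -
  have 1: "(quad \<phi> f A B C D)\<^sup>2 \<le> quad \<phi> f A B A B * quad \<phi> f C D C D"
    unfolding quad_eq_ker_sum by (rule ker_sum_Cauchy_Schwarz) (use fin in auto)
  have 2: "(quad \<phi> f A B A B)\<^sup>2 \<le> energy \<phi> f A * energy \<phi> f B"
    if "finite A" "finite B" for A B
    unfolding quad_eq_ker_sum_diff by (rule ker_sum_Cauchy_Schwarz) (use that in auto)
  have "quad \<phi> f A B C D ^ 4 = ((quad \<phi> f A B C D)\<^sup>2)\<^sup>2" by simp
  also have "\<dots> \<le> (quad \<phi> f A B A B * quad \<phi> f C D C D)\<^sup>2"
    by (intro power_mono 1) auto
  also have "\<dots> = (quad \<phi> f A B A B)\<^sup>2 * (quad \<phi> f C D C D)\<^sup>2" by (simp add: power_mult_distrib)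
  also have "\<dots> \<le> (energy \<phi> f A * energy \<phi> f B) * (energy \<phi> f C * energy \<phi> f D)"
    using f by (intro mult_mono 2 fin mult_nonneg_nonneg quad_nonneg) auto
  finally show ?thesis by (simp add: mult.assoc)
qed

text \<open>A quadruple of fibres over i, j, k, l contributes only if i + j = k + l, and then at
  most the geometric mean of the four fibre energies. What remains is an energy on the integers,
  whatever the group of \<phi> is.\<close>

lemma energy_le_fibre_energy:
  fixes v :: "'a \<Rightarrow> int"
  assumes fin: "finite A" and f: "\<And>a. a \<in> A \<Longrightarrow> 0 \<le> f a"
    and hom: "\<And>a b c d. \<lbrakk>a \<in> A; b \<in> A; c \<in> A; d \<in> A; \<phi> a + \<phi> b = \<phi> c + \<phi> d\<rbrakk> \<Longrightarrow> v a + v b = v c + v d"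
    and e: "\<And>i. i \<in> v ` A \<Longrightarrow> 0 \<le> e i" "\<And>i. i \<in> v ` A \<Longrightarrow> e i ^ 4 = energy \<phi> f {a \<in> A. v a = i}"
  shows "energy \<phi> f A \<le> energy id e (v ` A)"
proof -
  define S where "S = (\<lambda>i. {a \<in> A. v a = i})"
  have grp: "(\<Sum>a\<in>A. g a) = (\<Sum>i\<in>v ` A. \<Sum>a\<in>S i. g a)" for g :: "'a \<Rightarrow> real"
    using sum.image_gen[OF fin, of g v] by (simp add: S_def)
  have sw: "(\<Sum>a\<in>S i. \<Sum>j\<in>v`A. g a j) = (\<Sum>j\<in>v`A. \<Sum>a\<in>S i. g a j)" for i and g :: "'a \<Rightarrow> int \<Rightarrow> real"
    by (rule sum.swap)
  have le: "quad \<phi> f (S i) (S j) (S k) (S l) \<le> (if i + j = k + l then e i * e j * e k * e l else 0)"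
    if ijkl: "i \<in> v ` A" "j \<in> v ` A" "k \<in> v ` A" "l \<in> v ` A" for i j k l
  proof (cases "i + j = k + l")
    case True
    have "quad \<phi> f (S i) (S j) (S k) (S l) ^ 4 \<le> (e i * e j * e k * e l) ^ 4"
    proof -
      have "quad \<phi> f (S i) (S j) (S k) (S l) ^ 4
          \<le> energy \<phi> f (S i) * energy \<phi> f (S j) * energy \<phi> f (S k) * energy \<phi> f (S l)"
        by (rule quad_le_prod_energy) (use fin f in \<open>auto simp: S_def\<close>)
      then show ?thesis using ijkl by (simp add: S_def e(2) power_mult_distrib)
    qed
    moreover have "0 \<le> e i * e j * e k * e l" using e(1) ijkl by simp
    ultimately have "quad \<phi> f (S i) (S j) (S k) (S l) \<le> e i * e j * e k * e l"
      using power_le_imp_le_base[of _ 3] by (simp add: numeral_eq_Suc)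
    then show ?thesis using True by simp
  next
    case False
    have "quad \<phi> f (S i) (S j) (S k) (S l) = 0"
      unfolding quad_def S_def using False hom by (intro sum.neutral ballI) auto
    then show ?thesis using False by simp
  qed
  have "energy \<phi> f A = (\<Sum>i\<in>v ` A. \<Sum>j\<in>v ` A. \<Sum>k\<in>v ` A. \<Sum>l\<in>v ` A. quad \<phi> f (S i) (S j) (S k) (S l))"
  proof -
    let ?t = "\<lambda>a b c d. if \<phi> a + \<phi> b = \<phi> c + \<phi> d then f a * f b * f c * f d else 0"
    have "energy \<phi> f A = (\<Sum>i\<in>v`A. \<Sum>a\<in>S i. \<Sum>j\<in>v`A. \<Sum>b\<in>S j. \<Sum>k\<in>v`A. \<Sum>c\<in>S k. \<Sum>l\<in>v`A. \<Sum>d\<in>S l. ?t a b c d)"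
      unfolding quad_def by (simp only: grp)
    also have "\<dots> = (\<Sum>i\<in>v`A. \<Sum>j\<in>v`A. \<Sum>k\<in>v`A. \<Sum>l\<in>v`A. \<Sum>a\<in>S i. \<Sum>b\<in>S j. \<Sum>c\<in>S k. \<Sum>d\<in>S l. ?t a b c d)"
      by (simp only: sw)
    finally show ?thesis unfolding quad_def .
  qed
  also have "\<dots> \<le> energy id e (v ` A)"
    unfolding quad_def[of id] id_apply by (intro sum_mono le)
  finally show ?thesis .
qed

section \<open>Young's inequality with constant 1, for cubes\<close>

lemma power34_AM_GM:
  fixes x y :: real
  shows "x^3 * y^3 \<le> (x^4 * y^2 + x^2 * y^4) / 2"
proof -
  have "0 \<le> x\<^sup>2 * y\<^sup>2 * (x - y)\<^sup>2" by simp
  also have "\<dots> = x^4 * y^2 + x^2 * y^4 - 2 * (x^3 * y^3)"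
    by (simp add: power2_eq_square power3_eq_cube power4_eq_xxxx algebra_simps)
  finally show ?thesis by simp
qed

text \<open>For injective \<phi> this is the Bhattacharyya overlap of the mass \<open>r ^ 4\<close>
  with its translate by z.\<close>

definition affinity :: "('a \<Rightarrow> 'b::ab_group_add) \<Rightarrow> ('a \<Rightarrow> real) \<Rightarrow> 'a set \<Rightarrow> 'b \<Rightarrow> real" where
  "affinity \<phi> r A z = (\<Sum>d\<in>A. \<Sum>b\<in>A. if z = \<phi> d - \<phi> b then (r d)\<^sup>2 * (r b)\<^sup>2 else 0)"

text \<open>AM-GM puts the fourth powers on one of the two pairs and the squares on the other;
  exchanging the pairs shows that both resulting sums agree. In this form the deficit in Young's
  inequality is visible: it comes from differences along which the mass overlaps badly with its
  translate.\<close>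

lemma energy_cube_le:
  "energy \<phi> (\<lambda>a. r a ^ 3) A \<le> (\<Sum>a\<in>A. \<Sum>c\<in>A. r a ^ 4 * r c ^ 4 * affinity \<phi> r A (\<phi> a - \<phi> c))"
proof -
  let ?P = "\<lambda>a c d b. if \<phi> a - \<phi> c = \<phi> d - \<phi> b then (r a ^ 4 * r c ^ 4) * ((r d)\<^sup>2 * (r b)\<^sup>2) else 0"
  let ?Q = "\<lambda>a c d b. if \<phi> a - \<phi> c = \<phi> d - \<phi> b then (r d ^ 4 * r b ^ 4) * ((r a)\<^sup>2 * (r c)\<^sup>2) else 0"
  have eq: "energy \<phi> (\<lambda>a. r a ^ 3) A = (\<Sum>a\<in>A. \<Sum>c\<in>A. \<Sum>d\<in>A. \<Sum>b\<in>A.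
      if \<phi> a - \<phi> c = \<phi> d - \<phi> b then (r a * r c) ^ 3 * (r d * r b) ^ 3 else 0)"
    unfolding quad_eq_ker_sum_diff ker_sum_def
    by (auto simp: sum.cartesian_product' power_mult_distrib intro!: sum.cong)
  also have "\<dots> \<le> (\<Sum>a\<in>A. \<Sum>c\<in>A. \<Sum>d\<in>A. \<Sum>b\<in>A. (?P a c d b + ?Q a c d b) / 2)"
  proof (intro sum_mono)
    fix a c d b
    show "(if \<phi> a - \<phi> c = \<phi> d - \<phi> b then (r a * r c) ^ 3 * (r d * r b) ^ 3 else 0)
        \<le> (?P a c d b + ?Q a c d b) / 2"
      using power34_AM_GM[of "r a * r c" "r d * r b"]
      by (auto simp: power_mult_distrib mult_ac)
  qed
  also have "\<dots> = ((\<Sum>a\<in>A. \<Sum>c\<in>A. \<Sum>d\<in>A. \<Sum>b\<in>A. ?P a c d b) + (\<Sum>a\<in>A. \<Sum>c\<in>A. \<Sum>d\<in>A. \<Sum>b\<in>A. ?Q a c d b)) / 2"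
    by (simp only: sum.distrib sum_divide_distrib[symmetric])
  also have "(\<Sum>a\<in>A. \<Sum>c\<in>A. \<Sum>d\<in>A. \<Sum>b\<in>A. ?Q a c d b) = (\<Sum>d\<in>A. \<Sum>b\<in>A. \<Sum>a\<in>A. \<Sum>c\<in>A. ?Q a c d b)"
  proof -
    have "(\<Sum>x\<in>A\<times>A. \<Sum>y\<in>A\<times>A. ?Q (fst x) (snd x) (fst y) (snd y)) = (\<Sum>y\<in>A\<times>A. \<Sum>x\<in>A\<times>A. ?Q (fst x) (snd x) (fst y) (snd y))"
      by (rule sum.swap)
    then show ?thesis by (simp add: sum.cartesian_product' cong: if_cong)
  qed
  also have "\<dots> = (\<Sum>a\<in>A. \<Sum>c\<in>A. \<Sum>d\<in>A. \<Sum>b\<in>A. ?P a c d b)"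
    by (intro sum.cong refl) auto
  also have "\<dots> = (\<Sum>a\<in>A. \<Sum>c\<in>A. r a ^ 4 * r c ^ 4 * affinity \<phi> r A (\<phi> a - \<phi> c))"
    unfolding affinity_def by (auto simp: sum_distrib_left intro!: sum.cong)
  finally show ?thesis by simp
qed

lemma ker_sum_inj:
  assumes "finite X" "inj_on k X"
  shows "ker_sum k F X k F X = (\<Sum>x\<in>X. (F x)\<^sup>2)"
proof -
  have "(\<Sum>y\<in>X. if k x = k y then F x * F y else 0) = (F x)\<^sup>2" if "x \<in> X" for x
  proof -
    have "(\<Sum>y\<in>X. if k x = k y then F x * F y else 0) = (\<Sum>y\<in>X. if x = y then F x * F y else 0)"
      using assms that by (intro sum.cong refl) (auto simp: inj_on_def)
    then show ?thesis using assms that by (simp add: power2_eq_square)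
  qed
  then show ?thesis unfolding ker_sum_def by simp
qed

text \<open>For fixed z and injective \<phi> the relation z = \<phi> d - \<phi> b is a partial
  matching, so Cauchy-Schwarz loses no multiplicity.\<close>

lemma sum_matching_le:
  fixes \<phi> :: "'a \<Rightarrow> 'b::ab_group_add"
  assumes "finite A" "inj_on \<phi> A"
  shows "(\<Sum>d\<in>A. \<Sum>b\<in>A. if z = \<phi> d - \<phi> b then g d * h b else 0)
    \<le> sqrt ((\<Sum>a\<in>A. (g a)\<^sup>2) * (\<Sum>a\<in>A. (h a)\<^sup>2))"
proof -
  have "(\<Sum>d\<in>A. \<Sum>b\<in>A. if z = \<phi> d - \<phi> b then g d * h b else 0) = ker_sum (\<lambda>d. \<phi> d - z) g A \<phi> h A"
    unfolding ker_sum_def by (intro sum.cong refl) (auto simp: algebra_simps)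
  moreover have "inj_on (\<lambda>d. \<phi> d - z) A" using assms by (auto simp: inj_on_def)
  ultimately show ?thesis
    using ker_sum_Cauchy_Schwarz[of A A "\<lambda>d. \<phi> d - z" g \<phi> h] assms
    by (intro real_le_rsqrt) (simp only: ker_sum_inj)
qed

lemma affinity_le:
  assumes "finite A" "inj_on \<phi> A"
  shows "affinity \<phi> r A z \<le> (\<Sum>a\<in>A. r a ^ 4)"
proof -
  have "((r a)\<^sup>2)\<^sup>2 = r a ^ 4" for a by simp
  moreover have "0 \<le> (\<Sum>a\<in>A. r a ^ 4)" by (intro sum_nonneg) auto
  ultimately have "sqrt ((\<Sum>a\<in>A. ((r a)\<^sup>2)\<^sup>2) * (\<Sum>a\<in>A. ((r a)\<^sup>2)\<^sup>2)) = (\<Sum>a\<in>A. r a ^ 4)"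
    by simp
  then show ?thesis
    using sum_matching_le[OF assms, of z "\<lambda>a. (r a)\<^sup>2" "\<lambda>a. (r a)\<^sup>2"]
    unfolding affinity_def by linarith
qed

lemma energy_cube_le_cube_sum:
  assumes "finite A" "inj_on \<phi> A"
  shows "energy \<phi> (\<lambda>a. r a ^ 3) A \<le> (\<Sum>a\<in>A. r a ^ 4) ^ 3"
proof -
  let ?P = "\<Sum>a\<in>A. r a ^ 4"
  have "energy \<phi> (\<lambda>a. r a ^ 3) A \<le> (\<Sum>a\<in>A. \<Sum>c\<in>A. r a ^ 4 * r c ^ 4 * affinity \<phi> r A (\<phi> a - \<phi> c))"
    by (rule energy_cube_le)
  also have "\<dots> \<le> (\<Sum>a\<in>A. \<Sum>c\<in>A. r a ^ 4 * r c ^ 4 * ?P)"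
    by (intro sum_mono mult_left_mono affinity_le assms) auto
  also have "\<dots> = ?P ^ 3"
    by (simp add: sum_distrib_right[symmetric] sum_distrib_left[symmetric] power3_eq_cube)
  finally show ?thesis .
qed

section \<open>Energies on the integers\<close>

text \<open>The least a whose closed lower mass reaches c; the open lower mass at a is the closed
  one at its predecessor, hence still below c.\<close>

lemma ex_quantile:
  fixes I :: "'a::linorder set" and w :: "'a \<Rightarrow> real"
  assumes "finite I" "0 < c" "c \<le> sum w I"
  shows "\<exists>a\<in>I. c \<le> (\<Sum>i\<in>{i\<in>I. i \<le> a}. w i) \<and> (\<Sum>i\<in>{i\<in>I. i < a}. w i) \<le> c"
proof -
  define T where "T = {a\<in>I. c \<le> (\<Sum>i\<in>{i\<in>I. i \<le> a}. w i)}"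
  have "I \<noteq> {}" using assms by auto
  then have "Max I \<in> T"
  proof -
    have "{i\<in>I. i \<le> Max I} = I" using assms by auto
    then show ?thesis using assms \<open>I \<noteq> {}\<close> by (simp add: T_def)
  qed
  moreover have "finite T" using assms by (simp add: T_def)
  ultimately have "Min T \<in> T" and min: "\<And>t. t \<in> T \<Longrightarrow> Min T \<le> t" by (auto intro: Min_in)
  have "(\<Sum>i\<in>{i\<in>I. i < Min T}. w i) \<le> c"
  proof (cases "{i\<in>I. i < Min T} = {}")
    case True
    show ?thesis unfolding True using assms(2) by simp
  next
    case False
    define a' where "a' = Max {i\<in>I. i < Min T}"
    have a': "a' \<in> {i\<in>I. i < Min T}" unfolding a'_def using False assms by (intro Max_in) auto
    have eq: "{i\<in>I. i < Min T} = {i\<in>I. i \<le> a'}"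
      using a' assms by (auto simp: a'_def)
    have "a' \<notin> T" using min[of a'] a' by auto
    then show ?thesis unfolding eq using a' by (simp add: T_def)
  qed
  then show ?thesis using \<open>Min T \<in> T\<close> by (auto simp: T_def)
qed

text \<open>If \<open>b \<le> i\<close>, \<open>k \<le> a\<close> and \<open>d - e = i - k\<close>, then \<open>e \<le> a\<close> or \<open>b < d\<close>. When \<open>a\<close> and \<open>b\<close> are the lower and
  the upper \<open>\<gamma>\<close>-quantile, this limits the overlap of the distribution with its translate by \<open>i - k\<close>.\<close>

lemma energy_int_spread:
  fixes I :: "int set" and r :: "int \<Rightarrow> real"
  defines "P \<equiv> \<Sum>i\<in>I. r i ^ 4"
  assumes fin: "finite I" and \<tau>: "0 < \<tau>" "\<tau> \<le> 1" and P: "0 < P"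
    and spread: "\<And>i. i \<in> I \<Longrightarrow> r i ^ 4 \<le> (1 - \<tau>) * P"
  shows "energy id (\<lambda>i. r i ^ 3) I \<le> P ^ 3 * (1 - \<tau> * (\<tau>\<^sup>2 / 64)\<^sup>2 / 4)"
proof -
  \<comment> \<open>Chosen so that its square root is \<tau>/8: the upper tail then adds \<tau>/8 to
    the overlap, while the missing lower mass removes almost \<tau>/2, which leaves a loss of
    \<tau>/4.\<close>
  define \<gamma> where "\<gamma> = \<tau>\<^sup>2 / 64"
  let ?p = "\<lambda>i. r i ^ 4"
  have \<gamma>: "0 < \<gamma>" "\<gamma> \<le> 1" using \<tau> power_le_one[of \<tau> 2] by (auto simp: \<gamma>_def)
  have \<gamma>P: "0 < \<gamma> * P" "\<gamma> * P \<le> P" using \<gamma> P by (auto simp: mult_left_le_one_le)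
  obtain a where a: "a \<in> I" "\<gamma> * P \<le> (\<Sum>i\<in>{i\<in>I. i \<le> a}. ?p i)" "(\<Sum>i\<in>{i\<in>I. i < a}. ?p i) \<le> \<gamma> * P"
    using ex_quantile[OF fin \<gamma>P(1), of ?p] \<gamma>P by (auto simp: P_def)
  obtain b where b: "\<gamma> * P \<le> (\<Sum>i\<in>{i\<in>I. b \<le> i}. ?p i)" "(\<Sum>i\<in>{i\<in>I. b < i}. ?p i) \<le> \<gamma> * P"
  proof -
    \<comment> \<open>The upper quantile is the lower quantile of the reflected set.\<close>
    have P': "P = (\<Sum>i\<in>uminus ` I. ?p (- i))" by (simp add: P_def sum.reindex)
    have "\<exists>b'\<in>uminus ` I. \<gamma> * P \<le> (\<Sum>i\<in>{i\<in>uminus ` I. i \<le> b'}. ?p (- i)) \<and>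
        (\<Sum>i\<in>{i\<in>uminus ` I. i < b'}. ?p (- i)) \<le> \<gamma> * P"
    proof (rule ex_quantile)
      show "\<gamma> * P \<le> (\<Sum>i\<in>uminus ` I. ?p (- i))" using \<gamma>P(2) unfolding P'[symmetric] .
    qed (use fin \<gamma>P in simp_all)
    then obtain b' where b': "\<gamma> * P \<le> (\<Sum>i\<in>{i\<in>uminus ` I. i \<le> b'}. ?p (- i))"
        "(\<Sum>i\<in>{i\<in>uminus ` I. i < b'}. ?p (- i)) \<le> \<gamma> * P"
      by blast
    have "{i\<in>uminus ` I. i \<le> b'} = uminus ` {i\<in>I. - b' \<le> i}" "{i\<in>uminus ` I. i < b'} = uminus ` {i\<in>I. - b' < i}"
      by auto
    then show ?thesis using b' by (intro that[of "- b'"]) (simp_all add: sum.reindex)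
  qed
  \<comment> \<open>The spread hypothesis enters here: the atom at a may overshoot the quantile, but
    carries at most the share 1 - \<tau>.\<close>
  have le_a: "(\<Sum>i\<in>{i\<in>I. i \<le> a}. ?p i) \<le> (1 - \<tau> + \<gamma>) * P"
  proof -
    have "{i\<in>I. i \<le> a} = insert a {i\<in>I. i < a}" using a by auto
    then have "(\<Sum>i\<in>{i\<in>I. i \<le> a}. ?p i) = ?p a + (\<Sum>i\<in>{i\<in>I. i < a}. ?p i)" using fin by simp
    then show ?thesis using a spread[of a] by (simp add: algebra_simps)
  qed
  have aff: "affinity id r I (i - k) \<le> (1 - \<tau> / 4) * P" if "b \<le> i" "k \<le> a" for i k
  proof -
    let ?z = "i - k"
    let ?g = "\<lambda>e. if e \<le> a then (r e)\<^sup>2 else 0" and ?h = "\<lambda>d. if b < d then (r d)\<^sup>2 else 0"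
    have sq: "(\<Sum>i\<in>I. ((r i)\<^sup>2)\<^sup>2) = P" by (simp add: P_def flip: power_mult)
    have sqg: "(\<Sum>i\<in>I. (?g i)\<^sup>2) = (\<Sum>i\<in>{i\<in>I. i \<le> a}. ?p i)"
      using fin by (simp add: sum.inter_filter if_distrib[of "\<lambda>x. x\<^sup>2"] flip: power_mult cong: if_cong)
    have sqh: "(\<Sum>i\<in>I. (?h i)\<^sup>2) = (\<Sum>i\<in>{i\<in>I. b < i}. ?p i)"
      using fin by (simp add: sum.inter_filter if_distrib[of "\<lambda>x. x\<^sup>2"] flip: power_mult cong: if_cong)
    have "affinity id r I ?z \<le> (\<Sum>d\<in>I. \<Sum>e\<in>I. (if ?z = id d - id e then (r d)\<^sup>2 * ?g e else 0)
        + (if ?z = id d - id e then ?h d * (r e)\<^sup>2 else 0))"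
      unfolding affinity_def using that by (intro sum_mono) auto
    also have "\<dots> = (\<Sum>d\<in>I. \<Sum>e\<in>I. if ?z = id d - id e then (r d)\<^sup>2 * ?g e else 0)
        + (\<Sum>d\<in>I. \<Sum>e\<in>I. if ?z = id d - id e then ?h d * (r e)\<^sup>2 else 0)"
      by (simp only: sum.distrib)
    also have "\<dots> \<le> sqrt (P * (\<Sum>i\<in>{i\<in>I. i \<le> a}. ?p i)) + sqrt ((\<Sum>i\<in>{i\<in>I. b < i}. ?p i) * P)"
      using sum_matching_le[OF fin inj_on_id, of ?z "\<lambda>d. (r d)\<^sup>2" ?g]
        sum_matching_le[OF fin inj_on_id, of ?z ?h "\<lambda>d. (r d)\<^sup>2"]
      unfolding sq sqg sqh by linarith
    also have "\<dots> \<le> (1 - (\<tau> - \<gamma>) / 2) * P + \<tau> / 8 * P"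
    proof (intro add_mono real_le_lsqrt)
      have "P * (\<Sum>i\<in>{i\<in>I. i \<le> a}. ?p i) \<le> P * ((1 - \<tau> + \<gamma>) * P)"
        using le_a P by (intro mult_left_mono) auto
      also have "\<dots> \<le> ((1 - (\<tau> - \<gamma>) / 2) * P)\<^sup>2"
      proof -
        have "0 \<le> ((\<tau> - \<gamma>) / 2 * P)\<^sup>2" by simp
        then show ?thesis by (simp add: power2_eq_square algebra_simps)
      qed
      finally show "P * (\<Sum>i\<in>{i\<in>I. i \<le> a}. ?p i) \<le> ((1 - (\<tau> - \<gamma>) / 2) * P)\<^sup>2" .
      have "(\<Sum>i\<in>{i\<in>I. b < i}. ?p i) * P \<le> \<gamma> * P * P"
        using b P by (intro mult_right_mono) auto
      also have "\<dots> = (\<tau> / 8 * P)\<^sup>2" by (simp add: \<gamma>_def power2_eq_square)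
      finally show "(\<Sum>i\<in>{i\<in>I. b < i}. ?p i) * P \<le> (\<tau> / 8 * P)\<^sup>2" .
    qed (use \<tau> \<gamma> P in \<open>auto intro!: mult_nonneg_nonneg\<close>)
    also have "\<dots> = (1 - \<tau> / 4 - (\<tau> / 8 - \<gamma> / 2)) * P" by (simp add: field_simps)
    also have "\<dots> \<le> (1 - \<tau> / 4) * P"
    proof -
      have "\<tau>\<^sup>2 \<le> \<tau>" using \<tau> by (simp add: power2_eq_square mult_left_le)
      then have "\<gamma> / 2 \<le> \<tau> / 8" using \<tau> unfolding \<gamma>_def by linarith
      then show ?thesis using P by (intro mult_right_mono) auto
    qed
    finally show ?thesis .
  qed
  have "energy id (\<lambda>i. r i ^ 3) I \<le> (\<Sum>i\<in>I. \<Sum>k\<in>I. ?p i * ?p k * affinity id r I (id i - id k))"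
    by (rule energy_cube_le)
  \<comment> \<open>Pairs with b \<le> i and k \<le> a have product mass at least (\<gamma> P)^2 and
    each save the share \<tau>/4; all other pairs get the trivial bound P for the overlap.\<close>
  also have "\<dots> \<le> (\<Sum>i\<in>I. \<Sum>k\<in>I. ?p i * ?p k * P - \<tau> / 4 * P * ((if b \<le> i then ?p i else 0) * (if k \<le> a then ?p k else 0)))"
  proof (intro sum_mono)
    fix i k
    show "?p i * ?p k * affinity id r I (id i - id k) \<le>
       ?p i * ?p k * P - \<tau> / 4 * P * ((if b \<le> i then ?p i else 0) * (if k \<le> a then ?p k else 0))"
    proof (cases "b \<le> i \<and> k \<le> a")
      case True
      have "?p i * ?p k * affinity id r I (id i - id k) \<le> ?p i * ?p k * ((1 - \<tau> / 4) * P)"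
        using aff True by (intro mult_left_mono) auto
      then show ?thesis using True by (simp add: algebra_simps)
    next
      case False
      have "?p i * ?p k * affinity id r I (id i - id k) \<le> ?p i * ?p k * P"
        unfolding P_def by (intro mult_left_mono affinity_le fin) auto
      then show ?thesis using False by auto
    qed
  qed
  also have "\<dots> = P * P * P - \<tau> / 4 * P * ((\<Sum>i\<in>{i\<in>I. b \<le> i}. ?p i) * (\<Sum>k\<in>{k\<in>I. k \<le> a}. ?p k))"
    unfolding sum_subtractf sum_distrib_right[symmetric] sum_distrib_left[symmetric] P_def
    using fin by (simp add: sum.inter_filter)
  also have "\<dots> \<le> P * P * P - \<tau> / 4 * P * ((\<gamma> * P) * (\<gamma> * P))"
    using a b \<tau> P \<gamma> by (intro diff_left_mono mult_left_mono mult_mono) (auto intro: sum_nonneg)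
  also have "\<dots> = P ^ 3 * (1 - \<tau> * \<gamma>\<^sup>2 / 4)"
    by (simp add: power2_eq_square power3_eq_cube algebra_simps)
  finally show ?thesis by (simp add: \<gamma>_def)
qed

lemma energy_int_eq_sum_squares:
  fixes I :: "int set"
  assumes "finite I" "finite Z" "\<And>i k. i \<in> I \<Longrightarrow> k \<in> I \<Longrightarrow> i - k \<in> Z"
  shows "energy id f I = (\<Sum>z\<in>Z. (\<Sum>i\<in>I. \<Sum>k\<in>I. if i - k = z then f i * f k else 0)\<^sup>2)"
proof -
  have eq: "(\<Sum>x\<in>{x \<in> I \<times> I. (case x of (a, c) \<Rightarrow> id a - id c) = z}. case x of (a, c) \<Rightarrow> f a * f c)
      = (\<Sum>i\<in>I. \<Sum>k\<in>I. if i - k = z then f i * f k else 0)" for z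
    by (simp only: sum.inter_filter[OF finite_cartesian_product[OF assms(1,1)]]
        sum.cartesian_product' prod.case id_apply)
  show ?thesis
    unfolding quad_eq_ker_sum_diff
    by (subst ker_sum_eq[where Z = Z]) (use assms in \<open>auto simp only: eq power2_eq_square, auto\<close>)
qed

text \<open>The energy is the square sum of the representation function of differences. At
  difference 0 that function is known exactly; elsewhere it has three parts, and (x + y + z)^2 costs
  the factor 3. Keeping 0 apart gives the leading term coefficient 1, so that a small deficit in it
  is not drowned.\<close>

lemma energy_int_remove_point:
  fixes I :: "int set" and f :: "int \<Rightarrow> real"
  assumes fin: "finite I" and i0: "i0 \<in> I" and f: "\<And>i. i \<in> I \<Longrightarrow> 0 \<le> f i"
  defines "J \<equiv> I - {i0}" and "s \<equiv> \<Sum>i\<in>I - {i0}. (f i)\<^sup>2"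
  shows "energy id f I \<le> f i0 ^ 4 + 8 * (f i0)\<^sup>2 * s + s\<^sup>2 + 3 * energy id f J"
proof -
  define Z where "Z = (\<lambda>(i,k). i - k) ` (I \<times> I)"
  define w where "w = (\<lambda>S z. \<Sum>i\<in>S. \<Sum>k\<in>S. if i - k = z then f i * f k else 0)"
  define L where "L = (\<lambda>z. \<Sum>k\<in>J. if i0 - k = z then f i0 * f k else 0)"
  define R where "R = (\<lambda>z. \<Sum>i\<in>J. if i - i0 = z then f i0 * f i else 0)"
  have finJ: "finite J" and i0J: "i0 \<notin> J" and IJ: "I = insert i0 J" and finZ: "finite Z"
    using fin i0 by (auto simp: J_def Z_def)
  have Z0: "0 \<in> Z" using i0 by (auto simp: Z_def intro!: image_eqI[of _ _ "(i0,i0)"])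
  have wI: "w I z = w J z + (if z = 0 then (f i0)\<^sup>2 else 0) + L z + R z" for z
    unfolding w_def L_def R_def IJ
    using finJ i0J by (auto simp: sum.distrib power2_eq_square mult.commute intro!: sum.cong)
  have w0: "w J 0 = s"
    unfolding w_def s_def J_def[symmetric] using finJ
    by (auto simp: power2_eq_square intro!: sum.cong)
  have LR0: "L 0 = 0" "R 0 = 0" using i0J by (auto simp: L_def R_def intro!: sum.neutral)
  have sumL: "(\<Sum>z\<in>Z. (L z)\<^sup>2) = (f i0)\<^sup>2 * s"
  proof -
    have "(\<Sum>z\<in>Z. (L z)\<^sup>2) = ker_sum (\<lambda>k. i0 - k) (\<lambda>k. f i0 * f k) J (\<lambda>k. i0 - k) (\<lambda>k. f i0 * f k) J"
      by (subst ker_sum_eq[OF finJ finJ finZ])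
        (auto simp: Z_def L_def power2_eq_square sum.inter_filter finJ IJ)
    then show ?thesis using finJ
      by (simp add: ker_sum_inj inj_on_def power_mult_distrib sum_distrib_left s_def J_def)
  qed
  have sumR: "(\<Sum>z\<in>Z. (R z)\<^sup>2) = (f i0)\<^sup>2 * s"
  proof -
    have "(\<Sum>z\<in>Z. (R z)\<^sup>2) = ker_sum (\<lambda>k. k - i0) (\<lambda>k. f i0 * f k) J (\<lambda>k. k - i0) (\<lambda>k. f i0 * f k) J"
      by (subst ker_sum_eq[OF finJ finJ finZ])
        (auto simp: Z_def R_def power2_eq_square sum.inter_filter finJ IJ)
    then show ?thesis using finJ
      by (simp add: ker_sum_inj inj_on_def power_mult_distrib sum_distrib_left s_def J_def)
  qed
  have EI: "energy id f I = (\<Sum>z\<in>Z. (w I z)\<^sup>2)"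
    unfolding w_def by (rule energy_int_eq_sum_squares) (use fin finZ in \<open>auto simp: Z_def\<close>)
  have EJ: "energy id f J = (\<Sum>z\<in>Z. (w J z)\<^sup>2)"
    unfolding w_def by (rule energy_int_eq_sum_squares) (use finJ finZ IJ in \<open>auto simp: Z_def\<close>)
  have three: "(x + y + z)\<^sup>2 \<le> 3 * (x\<^sup>2 + y\<^sup>2 + z\<^sup>2)" for x y z :: real
  proof -
    have "0 \<le> (x - y)\<^sup>2 + (y - z)\<^sup>2 + (x - z)\<^sup>2" by simp
    then show ?thesis by (simp add: power2_eq_square algebra_simps)
  qed
  have "energy id f I = (w I 0)\<^sup>2 + (\<Sum>z\<in>Z - {0}. (w I z)\<^sup>2)"
    unfolding EI using finZ Z0 by (simp add: sum.remove)
  also have "\<dots> \<le> ((f i0)\<^sup>2 + s)\<^sup>2 + (\<Sum>z\<in>Z - {0}. 3 * ((w J z)\<^sup>2 + (L z)\<^sup>2 + (R z)\<^sup>2))"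
  proof (intro add_mono sum_mono)
    show "(w I 0)\<^sup>2 \<le> ((f i0)\<^sup>2 + s)\<^sup>2" by (simp add: wI w0 LR0 add.commute)
    show "(w I z)\<^sup>2 \<le> 3 * ((w J z)\<^sup>2 + (L z)\<^sup>2 + (R z)\<^sup>2)" if "z \<in> Z - {0}" for z
      using three[of "w J z" "L z" "R z"] that by (simp add: wI)
  qed
  also have "\<dots> \<le> ((f i0)\<^sup>2 + s)\<^sup>2 + (\<Sum>z\<in>Z. 3 * ((w J z)\<^sup>2 + (L z)\<^sup>2 + (R z)\<^sup>2))"
    using finZ by (intro add_mono sum_mono2) auto
  also have "\<dots> = ((f i0)\<^sup>2 + s)\<^sup>2 + 3 * (energy id f J + (f i0)\<^sup>2 * s + (f i0)\<^sup>2 * s)"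
    by (simp add: sum_distrib_left[symmetric] sum.distrib sumL sumR EJ)
  also have "\<dots> = f i0 ^ 4 + 8 * (f i0)\<^sup>2 * s + s\<^sup>2 + 3 * energy id f J"
    by (simp add: power2_eq_square power4_eq_xxxx algebra_simps)
  finally show ?thesis .
qed

text \<open>These constants are chosen for convenience, not optimised: \<open>step_size\<close> has to be small compared
  with the gain in \<open>energy_int_spread\<close> for \<open>\<tau> = 10\<^bsup>-10\<^esup>\<close>, and \<open>loss_exp\<close> large compared with \<open>step_size\<^bsup>-2\<^esup>\<close>.\<close>

definition step_size :: real where "step_size = 1 / 10 ^ 57"

definition loss_exp :: real where "loss_exp = 10 ^ 120"

lemma loss_exp_ge: "6 \<le> loss_exp" "4 \<le> loss_exp" "0 < loss_exp"
  by (simp_all add: loss_exp_def)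

lemma step_size_pos: "0 < step_size"
  by (simp add: step_size_def)

lemma exp_step_size_le: "exp step_size \<le> 1 + 2 * step_size"
  using exp_bound[of step_size] by (simp add: step_size_def power2_eq_square)

text \<open>Bounds the contribution to P of the fibres with large \<eta>. It suffices that
  \<open>(loss_exp - 1) * step_size\<close> exceeds 10^57, as exp u \<ge> u.\<close>

lemma exp_step_size_powr_le: "exp step_size powr (1 - loss_exp) \<le> step_size"
proof -
  have "exp step_size powr (1 - loss_exp) = inverse (exp ((loss_exp - 1) * step_size))"
    by (simp add: powr_def algebra_simps flip: exp_minus)
  also have "\<dots> \<le> inverse (10 ^ 57)"
  proof (rule le_imp_inverse_le)
    have "(10::real) ^ 57 \<le> (loss_exp - 1) * step_size"
      by (simp add: loss_exp_def step_size_def)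
    also have "\<dots> \<le> exp ((loss_exp - 1) * step_size)"
      using exp_ge_add_one_self[of "(loss_exp - 1) * step_size"] by linarith
    finally show "(10::real) ^ 57 \<le> exp ((loss_exp - 1) * step_size)" .
  qed simp
  finally show ?thesis by (simp add: step_size_def field_simps)
qed

lemma power_le_max_powr:
  assumes "0 \<le> x" "real n \<le> c"
  shows "x ^ n \<le> max 1 (x powr c)"
proof (cases "x \<le> 1")
  case True
  then show ?thesis using assms by (simp add: power_le_one max.coboundedI1)
next
  case False
  then have "x ^ n = x powr real n" by (simp add: powr_realpow)
  also have "\<dots> \<le> x powr c" using False assms by (intro powr_mono) auto
  finally show ?thesis by simp
qed

text \<open>The dichotomy behind the induction on primes: here \<open>\<alpha> i\<close> is the relative mass of the
  fibre over \<open>i\<close>, and \<open>\<eta> i\<close> is its normalised energy relative to that of the whole set.\<close>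

lemma fibre_dichotomy:
  fixes I :: "int set" and r \<alpha> \<eta> :: "int \<Rightarrow> real"
  assumes fin: "finite I" and \<alpha>: "\<And>i. i \<in> I \<Longrightarrow> 0 < \<alpha> i" "sum \<alpha> I = 1"
    and \<eta>: "\<And>i. i \<in> I \<Longrightarrow> 0 \<le> \<eta> i"
    and r: "\<And>i. i \<in> I \<Longrightarrow> 0 \<le> r i" "\<And>i. i \<in> I \<Longrightarrow> r i ^ 4 = \<eta> i * \<alpha> i"
    and energy: "1 \<le> energy id (\<lambda>i. r i ^ 3) I"
  shows "(\<exists>i\<in>I. 1 \<le> \<eta> i powr loss_exp * \<alpha> i) \<or>
    1 \<le> (\<Sum>i\<in>{i\<in>I. exp step_size \<le> \<eta> i}. \<eta> i powr loss_exp * \<alpha> i)"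
proof (rule ccontr)
  let ?C = loss_exp and ?y = step_size
  let ?G = "{i\<in>I. exp ?y \<le> \<eta> i}"
  assume "\<not> ?thesis"
  then have single: "\<And>i. i \<in> I \<Longrightarrow> \<eta> i powr ?C * \<alpha> i < 1"
    and good: "(\<Sum>i\<in>?G. \<eta> i powr ?C * \<alpha> i) < 1" by (auto simp: not_le)
  define \<tau> :: real where "\<tau> = 1 / 10 ^ 10"
  define P where "P = (\<Sum>i\<in>I. r i ^ 4)"
  have P_ge: "1 \<le> P"
  proof (rule ccontr)
    assume "\<not> 1 \<le> P"
    moreover have "0 \<le> P" by (auto simp: P_def intro!: sum_nonneg)
    ultimately have "P ^ 3 < 1 ^ 3" by (intro power_strict_mono) auto
    then show False using energy_cube_le_cube_sum[OF fin inj_on_id, of r] energy by (simp add: P_def)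
  qed
  have split: "\<eta> i * \<alpha> i = (\<eta> i powr ?C * \<alpha> i) * \<eta> i powr (1 - ?C)" if "0 < \<eta> i" for i
  proof -
    have "\<eta> i = \<eta> i powr ?C * \<eta> i powr (1 - ?C)" using that by (simp flip: powr_add)
    then show ?thesis by (metis mult.assoc mult.commute)
  qed
  \<comment> \<open>Fibres with \<eta> below \<open>exp step_size\<close> contribute at most this
    factor times their mass. For the others, \<eta> is \<eta>^C times \<eta>^(1 - C): the first
    factors sum to less than 1 by \<open>good\<close>, the second are at most
    \<open>step_size\<close>.\<close>
  have P_le: "P \<le> 1 + 3 * ?y"
  proof -
    have "P = (\<Sum>i\<in>I. \<eta> i * \<alpha> i)" by (simp add: P_def r)
    also have "\<dots> = (\<Sum>i\<in>I - ?G. \<eta> i * \<alpha> i) + (\<Sum>i\<in>?G. \<eta> i * \<alpha> i)"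
      using fin by (intro sum.subset_diff) auto
    also have "\<dots> \<le> (\<Sum>i\<in>I. exp ?y * \<alpha> i) + (\<Sum>i\<in>?G. (\<eta> i powr ?C * \<alpha> i) * exp ?y powr (1 - ?C))"
    proof (intro add_mono)
      have "(\<Sum>i\<in>I - ?G. \<eta> i * \<alpha> i) \<le> (\<Sum>i\<in>I - ?G. exp ?y * \<alpha> i)"
        using \<alpha>(1) by (intro sum_mono mult_right_mono) (auto intro: less_imp_le)
      also have "\<dots> \<le> (\<Sum>i\<in>I. exp ?y * \<alpha> i)"
        using fin \<alpha>(1) by (intro sum_mono2) (auto intro: less_imp_le)
      finally show "(\<Sum>i\<in>I - ?G. \<eta> i * \<alpha> i) \<le> (\<Sum>i\<in>I. exp ?y * \<alpha> i)" .
      show "(\<Sum>i\<in>?G. \<eta> i * \<alpha> i) \<le> (\<Sum>i\<in>?G. (\<eta> i powr ?C * \<alpha> i) * exp ?y powr (1 - ?C))"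
      proof (rule sum_mono)
        fix i assume i: "i \<in> ?G"
        then have pos: "0 < \<eta> i" by (auto intro: less_le_trans[OF exp_gt_zero])
        show "\<eta> i * \<alpha> i \<le> (\<eta> i powr ?C * \<alpha> i) * exp ?y powr (1 - ?C)"
          unfolding split[OF pos] using i \<alpha>(1)[of i] loss_exp_ge
          by (intro mult_left_mono powr_mono2') auto
      qed
    qed
    also have "\<dots> \<le> exp ?y * 1 + 1 * ?y"
      unfolding sum_distrib_left[symmetric] sum_distrib_right[symmetric] \<alpha>(2)
      using good exp_step_size_powr_le by (intro add_mono mult_mono) (auto intro: less_imp_le)
    finally show ?thesis using exp_step_size_le by simp
  qed
  \<comment> \<open>P is hardly above 1 and the energy is at least 1, so Young's inequality is
    almost sharp, which a spread mass forbids.\<close>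
  have "\<exists>i\<in>I. (1 - \<tau>) * P < r i ^ 4"
  proof (rule ccontr)
    assume "\<not> ?thesis"
    then have "energy id (\<lambda>i. r i ^ 3) I \<le> P ^ 3 * (1 - \<tau> * (\<tau>\<^sup>2 / 64)\<^sup>2 / 4)"
      unfolding P_def using fin P_ge by (intro energy_int_spread) (auto simp: \<tau>_def P_def not_less)
    also have "\<dots> \<le> (1 + 3 * ?y) ^ 3 * (1 - \<tau> * (\<tau>\<^sup>2 / 64)\<^sup>2 / 4)"
      using P_le P_ge by (intro mult_right_mono power_mono) (auto simp: \<tau>_def power2_eq_square)
    \<comment> \<open>The saving is about 6 * 10^(-55), the excess of the cube only about 9 *
      10^(-57).\<close>
    also have "\<dots> < 1" by (simp add: \<tau>_def step_size_def power2_eq_square power3_eq_cube)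
    finally show False using energy by simp
  qed
  then obtain i0 where i0: "i0 \<in> I" "(1 - \<tau>) * P < r i0 ^ 4" by auto
  define J where "J = I - {i0}"
  define x where "x = 1 - \<alpha> i0"
  have finJ: "finite J" using fin by (simp add: J_def)
  have sumJ: "sum \<alpha> J = x" using fin i0 \<alpha> by (simp add: J_def x_def sum_diff1)
  have x0: "0 \<le> x" unfolding sumJ[symmetric] using \<alpha>(1) by (intro sum_nonneg) (auto simp: J_def intro: less_imp_le)
  \<comment> \<open>If \<eta> exceeds 1, its n-th power is at most \<eta>^C, controlled by
    \<open>single\<close>; otherwise the relative mass \<alpha> \<le> 1 suffices.\<close>
  have pw: "\<eta> i0 ^ n * \<alpha> i0 \<le> 1" if "n \<le> 4" for n
  proof -
    have "\<eta> i0 ^ n * \<alpha> i0 \<le> max 1 (\<eta> i0 powr ?C) * \<alpha> i0"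
      using \<eta> \<alpha>(1) i0 that loss_exp_ge by (intro mult_right_mono power_le_max_powr) (auto intro: less_imp_le)
    also have "\<dots> \<le> 1" using single[OF i0(1)] x0 unfolding x_def by (auto simp: max_def)
    finally show ?thesis .
  qed
  have p0: "1 - \<tau> < r i0 ^ 4"
    using i0 P_ge mult_left_mono[of 1 P "1 - \<tau>"] by (simp add: \<tau>_def)
  have "(r i0 ^ 4)\<^sup>2 = (\<eta> i0 ^ 2 * \<alpha> i0) * \<alpha> i0" using r(2) i0 by (simp add: power2_eq_square)
  also have "\<dots> \<le> 1 * \<alpha> i0" using \<alpha>(1)[of i0] i0 by (intro mult_right_mono pw) auto
  finally have "(r i0 ^ 4)\<^sup>2 \<le> \<alpha> i0" by simp
  moreover have "(1 - \<tau>)\<^sup>2 \<le> (r i0 ^ 4)\<^sup>2" using p0 by (intro power_mono) (auto simp: \<tau>_def)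
  ultimately have x_le: "x \<le> 2 * \<tau>" by (simp add: x_def power2_eq_square algebra_simps \<tau>_def)
  \<comment> \<open>The left side is (\<eta> \<alpha>)^3. One factor \<alpha> absorbs \<eta>^3, and
    the two that remain give the main term a deficit of first order in x.\<close>
  have u0: "(r i0 ^ 3) ^ 4 \<le> (1 - x)\<^sup>2"
  proof -
    have "(r i0 ^ 3) ^ 4 = (r i0 ^ 4) ^ 3" by (simp flip: power_mult)
    also have "\<dots> = (\<eta> i0 ^ 3 * \<alpha> i0) * (\<alpha> i0)\<^sup>2"
      using r(2) i0 by (simp add: power2_eq_square power3_eq_cube)
    also have "\<dots> \<le> 1 * (\<alpha> i0)\<^sup>2" by (intro mult_right_mono pw) auto
    finally show ?thesis by (simp add: x_def)
  qed
  show False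
  proof (cases "x = 0")
    case True
    have "J = {}"
    proof (rule ccontr)
      assume "J \<noteq> {}"
      then have "0 < sum \<alpha> J" using finJ \<alpha>(1) by (intro sum_pos) (auto simp: J_def)
      then show False using sumJ True by simp
    qed
    then have I: "I = {i0}" using i0 by (auto simp: J_def)
    have "\<alpha> i0 = 1" using True by (simp add: x_def)
    have "1 \<le> (r i0 ^ 4) ^ 3" using energy by (simp add: I quad_def flip: power_mult power_add)
    then have "1 \<le> r i0 ^ 4" using power_le_one_iff[of "r i0 ^ 4" 3] power_less_one_iff[of "r i0 ^ 4" 3] by force
    then have "1 \<le> \<eta> i0" using r(2) i0 \<open>\<alpha> i0 = 1\<close> by simp
    then have "1 \<le> \<eta> i0 powr ?C" using loss_exp_ge by (intro ge_one_powr_ge_zero) auto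
    then show False using single[OF i0(1)] \<open>\<alpha> i0 = 1\<close> by simp
  next
    case False
    then have xpos: "0 < x" using x0 by simp
    \<comment> \<open>The mass V off \<open>i0\<close> must have V^(3/2) of smaller order than the
      deficit x. Cutting at \<eta> = 1/\<xi> achieves this: below the cut V gets at most x/\<xi> =
      \<xi>^5, above it at most \<xi>^5 because \<open>loss_exp\<close> is at least 6. Then V^(3/2)
      is at most 4 \<xi>^7, against x = \<xi>^6.\<close>
    define \<xi> where "\<xi> = root 6 x"
    have \<xi>: "0 < \<xi>" "\<xi> ^ 6 = x" using xpos by (auto simp: \<xi>_def)
    have \<xi>_le: "\<xi> \<le> 1 / 30"
    proof (rule power_le_imp_le_base[of _ 5])
      show "\<xi> ^ Suc 5 \<le> (1 / 30) ^ Suc 5" using \<xi>(2) x_le by (simp add: \<tau>_def power_divide)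
    qed simp
    define V where "V = (\<Sum>i\<in>J. r i ^ 4)"
    have V0: "0 \<le> V" by (auto simp: V_def intro!: sum_nonneg)
    have "V \<le> (\<Sum>i\<in>J. 1 / \<xi> * \<alpha> i + (if i \<in> ?G then \<eta> i powr ?C * \<alpha> i * \<xi> ^ 5 else 0))"
      unfolding V_def
    proof (rule sum_mono)
      fix i assume "i \<in> J"
      then have i: "i \<in> I" by (auto simp: J_def)
      show "r i ^ 4 \<le> 1 / \<xi> * \<alpha> i + (if i \<in> ?G then \<eta> i powr ?C * \<alpha> i * \<xi> ^ 5 else 0)"
      proof (cases "\<eta> i \<le> 1 / \<xi>")
        case True
        then have "\<eta> i * \<alpha> i \<le> 1 / \<xi> * \<alpha> i" using \<alpha>(1)[OF i] by (intro mult_right_mono) auto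
        moreover have "0 \<le> (if i \<in> ?G then \<eta> i powr ?C * \<alpha> i * \<xi> ^ 5 else 0)"
          using \<alpha>(1)[OF i] \<xi> by simp
        ultimately show ?thesis using r(2)[OF i] by linarith
      next
        case False
        then have big: "1 / \<xi> < \<eta> i" by simp
        have "30 \<le> 1 / \<xi>" using \<xi> \<xi>_le by (simp add: field_simps)
        then have "30 < \<eta> i" using big by simp
        then have G: "i \<in> ?G" using exp_step_size_le i by (simp add: step_size_def)
        have "\<eta> i powr (1 - ?C) \<le> (1 / \<xi>) powr (1 - ?C)"
          using big \<xi> loss_exp_ge by (intro powr_mono2') auto
        also have "\<dots> \<le> (1 / \<xi>) powr (- 5)"
          using \<open>30 \<le> 1 / \<xi>\<close> loss_exp_ge by (intro powr_mono) auto
        also have "\<dots> = \<xi> ^ 5" using \<xi> by (simp add: powr_minus powr_divide powr_numeral field_simps)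
        finally have "\<eta> i powr (1 - ?C) \<le> \<xi> ^ 5" .
        then have "\<eta> i * \<alpha> i \<le> (\<eta> i powr ?C * \<alpha> i) * \<xi> ^ 5"
          unfolding split[OF less_trans[OF _ \<open>30 < \<eta> i\<close>, of 0, simplified]]
          using \<alpha>(1)[OF i] by (intro mult_left_mono) auto
        moreover have "0 \<le> 1 / \<xi> * \<alpha> i" using \<alpha>(1)[OF i] \<xi> by simp
        ultimately show ?thesis using r(2)[OF i] G by simp
      qed
    qed
    also have "\<dots> = 1 / \<xi> * sum \<alpha> J + (\<Sum>i\<in>{i\<in>J. i \<in> ?G}. \<eta> i powr ?C * \<alpha> i) * \<xi> ^ 5"
      unfolding sum.distrib sum_distrib_left sum_distrib_right sum.inter_filter[OF finJ]
      by (intro arg_cong2[of _ _ _ _ "(+)"] sum.cong refl) auto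
    also have "\<dots> \<le> 1 / \<xi> * \<xi> ^ 6 + 1 * \<xi> ^ 5"
    proof (rule add_mono)
      show "1 / \<xi> * sum \<alpha> J \<le> 1 / \<xi> * \<xi> ^ 6" by (simp only: sumJ \<xi> order_refl)
      have "(\<Sum>i\<in>{i\<in>J. i \<in> ?G}. \<eta> i powr ?C * \<alpha> i) \<le> (\<Sum>i\<in>?G. \<eta> i powr ?C * \<alpha> i)"
        using fin \<alpha>(1) by (intro sum_mono2 mult_nonneg_nonneg) (auto simp: J_def intro: less_imp_le)
      then have "(\<Sum>i\<in>{i\<in>J. i \<in> ?G}. \<eta> i powr ?C * \<alpha> i) \<le> 1" using good by linarith
      then show "(\<Sum>i\<in>{i\<in>J. i \<in> ?G}. \<eta> i powr ?C * \<alpha> i) * \<xi> ^ 5 \<le> 1 * \<xi> ^ 5"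
        using \<xi> by (intro mult_right_mono) auto
    qed
    also have "\<dots> = 2 * \<xi> ^ 5" using \<xi>(1) by (simp add: numeral_eq_Suc)
    finally have V: "V \<le> 2 * \<xi> ^ 5" .
    have \<xi>1: "\<xi> \<le> 1" using \<xi>_le by simp
    have sqV: "sqrt V \<le> 2 * \<xi>\<^sup>2"
    proof (rule real_le_lsqrt)
      have "\<xi> ^ 5 \<le> \<xi> ^ 4" using \<xi> \<xi>1 by (intro power_decreasing) auto
      moreover have "(2 * \<xi>\<^sup>2)\<^sup>2 = 4 * \<xi> ^ 4" by (simp add: power_mult_distrib flip: power_mult)
      ultimately show "V \<le> (2 * \<xi>\<^sup>2)\<^sup>2" using V zero_le_power[of \<xi> 4] \<xi> by linarith
    qed (use V0 \<xi> in auto)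
    have VV: "V * sqrt V \<le> 4 * \<xi> ^ 7"
    proof -
      have "V * sqrt V \<le> (2 * \<xi> ^ 5) * (2 * \<xi>\<^sup>2)" using V sqV V0 \<xi> by (intro mult_mono) auto
      also have "\<dots> = 4 * \<xi> ^ 7" by (simp add: numeral_eq_Suc)
      finally show ?thesis .
    qed
    have V_small: "V \<le> 1"
      using V power_le_one[of \<xi> 4] \<xi> \<xi>_le mult_mono[of "\<xi>^4" 1 \<xi> "1/30"] by (simp add: numeral_eq_Suc)
    define s where "s = (\<Sum>i\<in>J. (r i ^ 3)\<^sup>2)"
    have s0: "0 \<le> s" by (auto simp: s_def intro!: sum_nonneg)
    have s_le: "s \<le> V * sqrt V"
      unfolding s_def V_def sum_distrib_right
    proof (rule sum_mono)
      fix i assume i: "i \<in> J"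
      have "r i ^ 4 \<le> V" unfolding V_def using i finJ by (intro member_le_sum) auto
      then have "(r i)\<^sup>2 \<le> sqrt V" by (intro real_le_rsqrt) (simp flip: power_mult)
      then have "r i ^ 4 * (r i)\<^sup>2 \<le> r i ^ 4 * sqrt V" by (intro mult_left_mono) auto
      then show "(r i ^ 3)\<^sup>2 \<le> r i ^ 4 * sqrt (\<Sum>i\<in>J. r i ^ 4)"
        by (simp add: V_def flip: power_mult power_add)
    qed
    have sqV1: "sqrt V \<le> 1" using V_small by simp
    have s1: "s \<le> 1" using s_le mult_mono[of V 1 "sqrt V" 1] V0 V_small sqV1 by simp
    have EJ: "energy id (\<lambda>i. r i ^ 3) J \<le> V * sqrt V"
    proof -
      have "energy id (\<lambda>i. r i ^ 3) J \<le> V ^ 3"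
        unfolding V_def by (rule energy_cube_le_cube_sum[OF finJ inj_on_id])
      also have "\<dots> = (V * sqrt V) * (V * sqrt V)" using V0 by (simp add: power3_eq_cube)
      also have "\<dots> \<le> (V * sqrt V) * (1 * 1)" using V0 V_small sqV1 by (intro mult_left_mono mult_mono) auto
      finally show ?thesis by simp
    qed
    have u1: "(r i0 ^ 3)\<^sup>2 \<le> 1"
    proof -
      have "(1 - x)\<^sup>2 \<le> 1" using xpos x_le by (intro power_le_one) (auto simp: \<tau>_def)
      then have "((r i0 ^ 3)\<^sup>2)\<^sup>2 \<le> 1\<^sup>2" using u0 by (simp flip: power_mult)
      then show ?thesis by (rule power2_le_imp_le) simp
    qed
    have "1 \<le> (r i0 ^ 3) ^ 4 + 8 * (r i0 ^ 3)\<^sup>2 * s + s\<^sup>2 + 3 * energy id (\<lambda>i. r i ^ 3) J"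
      using energy_int_remove_point[OF fin i0(1), of "\<lambda>i. r i ^ 3"] r(1) energy
      by (simp add: s_def J_def)
    also have "\<dots> \<le> (1 - x)\<^sup>2 + 8 * 1 * (V * sqrt V) + V * sqrt V * 1 + 3 * (V * sqrt V)"
      unfolding power2_eq_square[of s]
      using u0 u1 s0 s1 s_le EJ V0 by (intro add_mono mult_mono mult_left_mono[of _ _ 3]) auto
    \<comment> \<open>The 8 + 1 + 3 error terms are each at most 4 \<xi>^7.\<close>
    also have "\<dots> \<le> (1 - x)\<^sup>2 + 48 * \<xi> ^ 7" using VV by simp
    also have "\<dots> = 1 - \<xi> ^ 6 * (2 - \<xi> ^ 6 - 48 * \<xi>)"
      unfolding \<xi>(2)[symmetric] by (simp add: power2_eq_square numeral_eq_Suc algebra_simps)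
    also have "\<dots> < 1"
    proof -
      have "\<xi> ^ 6 \<le> 1 / 30" using \<xi>(2) x_le by (simp add: \<tau>_def)
      then have "0 < 2 - \<xi> ^ 6 - 48 * \<xi>" using \<xi>_le by simp
      then have "0 < \<xi> ^ 6 * (2 - \<xi> ^ 6 - 48 * \<xi>)" using \<xi>(1) by simp
      then show ?thesis by linarith
    qed
    finally show False by simp
  qed
qed

section \<open>Weighted additive energies\<close>

text \<open>Characters of the integers mod M, with t as an exponent so that the sum over t is
  geometric. M is always taken larger than every signed sum in question; then a relation mod M is a
  relation over the integers, and finite averages replace integrals over the circle.\<close>

definition character :: "nat \<Rightarrow> int \<Rightarrow> nat \<Rightarrow> complex" where
  "character M z t = cis (2 * pi * real_of_int z / real M) ^ t"

lemma character_add: "character M (y + z) t = character M y t * character M z t"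
  by (simp add: character_def power_mult_distrib[symmetric] cis_mult ring_distribs add_divide_distrib)

lemma character_0: "character M 0 t = 1"
  by (simp add: character_def)

lemma character_uminus: "character M (- z) t = cnj (character M z t)"
  by (simp add: character_def cis_cnj)

lemma character_sum: "finite I \<Longrightarrow> character M (\<Sum>i\<in>I. z i) t = (\<Prod>i\<in>I. character M (z i) t)"
  by (induction I rule: finite_induct) (auto simp: character_0 character_add)

lemma sum_character:
  assumes "\<bar>z\<bar> < int M"
  shows "(\<Sum>t<M. character M z t) = (if z = 0 then of_nat M else 0)"
proof (cases "z = 0")
  case True
  then show ?thesis by (simp add: character_0)
next
  case False
  let ?c = "cis (2 * pi * real_of_int z / real M)"
  have M: "0 < M" using assms by auto
  have "?c \<noteq> 1"
  proof
    assume "?c = 1"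
    then have "cos (2 * pi * real_of_int z / real M) = 1" by (metis cis.sel(1) one_complex.sel(1))
    then obtain n :: int where "2 * pi * real_of_int z / real M = real_of_int n * 2 * pi"
      using cos_one_2pi_int by blast
    then have "real_of_int z = real_of_int (n * int M)" using M by (simp add: field_simps)
    then have "z = n * int M" by linarith
    with False assms show False
      by (auto simp: abs_mult mult_less_cancel_right2)
  qed
  moreover have "?c ^ M = 1"
    using M by (simp add: DeMoivre cis_multiple_2pi)
  ultimately show ?thesis using False by (simp add: character_def sum_gp_strict)
qed

definition add_solutions :: "nat \<Rightarrow> int set \<Rightarrow> (nat \<Rightarrow> int) set" where
  "add_solutions h S = {x \<in> {0..<2*h} \<rightarrow>\<^sub>E S. (\<Sum>i<h. x i) = (\<Sum>i\<in>{h..<2*h}. x i)}"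

definition weighted_energy :: "nat \<Rightarrow> int set \<Rightarrow> (int \<Rightarrow> real) \<Rightarrow> real" where
  "weighted_energy h S w = (\<Sum>x\<in>add_solutions h S. \<Prod>i\<in>{0..<2*h}. w (x i))"

definition side :: "nat \<Rightarrow> nat \<Rightarrow> int" where
  "side h i = (if i < h then 1 else - 1)"

lemma add_solutions_iff:
  "x \<in> add_solutions h S \<longleftrightarrow> x \<in> {0..<2*h} \<rightarrow>\<^sub>E S \<and> (\<Sum>i\<in>{0..<2*h}. side h i * x i) = 0"
proof -
  have "{0..<2*h} = {..<h} \<union> {h..<2*h}" by auto
  then have "(\<Sum>i\<in>{0..<2*h}. side h i * x i) = (\<Sum>i<h. side h i * x i) + (\<Sum>i\<in>{h..<2*h}. side h i * x i)"
    by (simp add: sum.union_disjoint ivl_disj_int)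
  also have "\<dots> = (\<Sum>i<h. x i) - (\<Sum>i\<in>{h..<2*h}. x i)"
    by (simp add: side_def sum_negf)
  finally show ?thesis by (auto simp: add_solutions_def)
qed

lemma finite_add_solutions: "finite S \<Longrightarrow> finite (add_solutions h S)"
  unfolding add_solutions_def by (rule finite_subset[OF _ finite_PiE[of "{0..<2*h}" "\<lambda>_. S"]]) auto

lemma add_energy_eq: "finite S \<Longrightarrow> real (add_energy h S) = weighted_energy h S (\<lambda>_. 1)"
  by (simp add: add_energy_def weighted_energy_def add_solutions_def)

definition fourier :: "nat \<Rightarrow> int set \<Rightarrow> (int \<Rightarrow> real) \<Rightarrow> nat \<Rightarrow> complex" where
  "fourier M S w t = (\<Sum>a\<in>S. of_real (w a) * character M a t)"

lemma modulus_pos: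
  assumes "2 * int h * (\<Sum>a\<in>S. \<bar>a\<bar>) < int M"
  shows "0 < M"
proof -
  have "0 \<le> 2 * int h * (\<Sum>a\<in>S. \<bar>a\<bar>)" by (intro mult_nonneg_nonneg sum_nonneg) auto
  then show ?thesis using assms by linarith
qed

text \<open>Orthogonality of characters. The weight may depend on the coordinate because Chang's
  inequality restricts just two of the coordinates to a fibre.\<close>

lemma sum_add_solutions_eq_fourier:
  assumes fin: "finite S" and M: "2 * int h * (\<Sum>a\<in>S. \<bar>a\<bar>) < int M"
  shows "complex_of_real (\<Sum>x\<in>add_solutions h S. \<Prod>i\<in>{0..<2*h}. W i (x i)) =
    (\<Sum>t<M. \<Prod>i\<in>{0..<2*h}. if i < h then fourier M S (W i) t else cnj (fourier M S (W i) t)) / of_nat M"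
proof -
  let ?I = "{0..<2*h}" and ?X = "{0..<2*h} \<rightarrow>\<^sub>E S"
  let ?s = "\<lambda>x. \<Sum>i\<in>?I. side h i * x i"
  have M0: "0 < M" using modulus_pos[OF M] .
  have bound: "\<bar>?s x\<bar> < int M" if "x \<in> ?X" for x
  proof -
    have "\<bar>?s x\<bar> \<le> (\<Sum>i\<in>?I. \<bar>side h i * x i\<bar>)" by (rule sum_abs)
    also have "\<dots> \<le> (\<Sum>i\<in>?I. \<Sum>a\<in>S. \<bar>a\<bar>)"
    proof (rule sum_mono)
      fix i assume "i \<in> ?I"
      then have "x i \<in> S" using that by auto
      then have "\<bar>x i\<bar> \<le> (\<Sum>a\<in>S. \<bar>a\<bar>)" using fin by (intro member_le_sum) auto
      then show "\<bar>side h i * x i\<bar> \<le> (\<Sum>a\<in>S. \<bar>a\<bar>)" by (simp add: side_def)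
    qed
    finally show ?thesis using M by simp
  qed
  have "(\<Prod>i\<in>?I. if i < h then fourier M S (W i) t else cnj (fourier M S (W i) t))
      = (\<Prod>i\<in>?I. \<Sum>a\<in>S. of_real (W i a) * character M (side h i * a) t)" for t
    by (intro prod.cong refl) (auto simp: fourier_def side_def character_uminus)
  also have "\<dots>t = (\<Sum>x\<in>?X. \<Prod>i\<in>?I. of_real (W i (x i)) * character M (side h i * x i) t)" for t
    by (rule prod_sum_PiE) (use fin in auto)
  finally have "(\<Sum>t<M. \<Prod>i\<in>?I. if i < h then fourier M S (W i) t else cnj (fourier M S (W i) t))
      = (\<Sum>t<M. \<Sum>x\<in>?X. (\<Prod>i\<in>?I. of_real (W i (x i))) * character M (?s x) t)"
    by (simp add: prod.distrib character_sum)
  also have "\<dots> = (\<Sum>x\<in>?X. (\<Prod>i\<in>?I. of_real (W i (x i))) * (\<Sum>t<M. character M (?s x) t))"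
    by (subst sum.swap) (simp add: sum_distrib_left)
  also have "\<dots> = (\<Sum>x\<in>?X. if ?s x = 0 then (\<Prod>i\<in>?I. of_real (W i (x i))) * of_nat M else 0)"
    using bound by (intro sum.cong refl) (simp add: sum_character)
  also have "\<dots> = (\<Sum>x\<in>{x\<in>?X. ?s x = 0}. (\<Prod>i\<in>?I. of_real (W i (x i))) * of_nat M)"
    by (rule sum.inter_filter[symmetric]) (simp add: fin finite_PiE)
  also have "{x\<in>?X. ?s x = 0} = add_solutions h S"
    by (rule set_eqI) (simp only: mem_Collect_eq add_solutions_iff)
  finally show ?thesis using M0 by (simp add: sum_distrib_right[symmetric])
qed

lemma sum_add_solutions_le:
  assumes "finite S" "2 * int h * (\<Sum>a\<in>S. \<bar>a\<bar>) < int M"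
  shows "(\<Sum>x\<in>add_solutions h S. \<Prod>i\<in>{0..<2*h}. W i (x i)) \<le>
    (\<Sum>t<M. \<Prod>i\<in>{0..<2*h}. cmod (fourier M S (W i) t)) / M"
proof -
  let ?s = "\<Sum>x\<in>add_solutions h S. \<Prod>i\<in>{0..<2*h}. W i (x i)"
  have "?s \<le> cmod (complex_of_real ?s)" by (metis abs_ge_self norm_of_real)
  also have "\<dots> \<le> (\<Sum>t<M. cmod (\<Prod>i\<in>{0..<2*h}. if i < h then fourier M S (W i) t else cnj (fourier M S (W i) t))) / M"
    unfolding sum_add_solutions_eq_fourier[OF assms] norm_divide norm_of_nat
    by (intro divide_right_mono norm_sum) auto
  also have "\<dots> = (\<Sum>t<M. \<Prod>i\<in>{0..<2*h}. cmod (fourier M S (W i) t)) / M"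
    unfolding prod_norm[symmetric]
    by (intro arg_cong2[of _ _ _ _ "(/)"] sum.cong prod.cong refl) auto
  finally show ?thesis .
qed

lemma weighted_energy_eq_fourier:
  assumes "finite S" "2 * int h * (\<Sum>a\<in>S. \<bar>a\<bar>) < int M"
  shows "weighted_energy h S w = (\<Sum>t<M. cmod (fourier M S w t) ^ (2 * h)) / M"
proof -
  have "(\<Prod>i\<in>{0..<2*h}. if i < h then fourier M S w t else cnj (fourier M S w t))
      = complex_of_real (cmod (fourier M S w t) ^ (2 * h))" for t
  proof -
    have "{0..<2*h} \<inter> {i. i < h} = {0..<h}" "{0..<2*h} \<inter> - {i. i < h} = {h..<2*h}" by auto
    then have "(\<Prod>i\<in>{0..<2*h}. if i < h then fourier M S w t else cnj (fourier M S w t))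
        = fourier M S w t ^ h * cnj (fourier M S w t) ^ h"
      by (simp add: prod.If_cases)
    also have "\<dots> = (fourier M S w t * cnj (fourier M S w t)) ^ h"
      by (simp add: power_mult_distrib)
    also have "\<dots> = complex_of_real (cmod (fourier M S w t) ^ (2 * h))"
      unfolding complex_norm_square[symmetric] by (simp add: power_mult)
    finally show ?thesis .
  qed
  note eq = this
  have "complex_of_real (weighted_energy h S w)
      = (\<Sum>t<M. \<Prod>i\<in>{0..<2*h}. if i < h then fourier M S w t else cnj (fourier M S w t)) / of_nat M"
    unfolding weighted_energy_def by (rule sum_add_solutions_eq_fourier[OF assms])
  also have "\<dots> = complex_of_real ((\<Sum>t<M. cmod (fourier M S w t) ^ (2 * h)) / M)"
    unfolding eq by simp
  finally show ?thesis by (simp only: of_real_eq_iff)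
qed

lemma weighted_energy_nonneg:
  assumes "\<And>a. a \<in> S \<Longrightarrow> 0 \<le> w a"
  shows "0 \<le> weighted_energy h S w"
  unfolding weighted_energy_def
  using assms by (intro sum_nonneg prod_nonneg) (auto simp: add_solutions_def PiE_iff)

lemma ex_modulus: "\<exists>M. 2 * int h * (\<Sum>a\<in>S. \<bar>a\<bar>) < int M"
  by (rule exI[of _ "nat (2 * int h * (\<Sum>a\<in>S. \<bar>a\<bar>)) + 1"]) simp

lemma modulus_mono:
  assumes "finite T" "S \<subseteq> T" "2 * int h * (\<Sum>a\<in>T. \<bar>a\<bar>) < int M"
  shows "2 * int h * (\<Sum>a\<in>S. \<bar>a\<bar>) < int M"
proof -
  have "(\<Sum>a\<in>S. \<bar>a\<bar>) \<le> (\<Sum>a\<in>T. \<bar>a\<bar>)" using assms by (intro sum_mono2) auto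
  then have "2 * int h * (\<Sum>a\<in>S. \<bar>a\<bar>) \<le> 2 * int h * (\<Sum>a\<in>T. \<bar>a\<bar>)" by (intro mult_left_mono) auto
  then show ?thesis using assms by linarith
qed

text \<open>Stands in for Hoelder's inequality once both factors are normalised; with a = 1 it also
  gives the concavity of x^(3/4).\<close>

lemma weighted_AM_GM_power:
  fixes a b :: real
  assumes "0 \<le> a" "0 \<le> b"
  shows "(real n + 1) * (a * b ^ n) \<le> a ^ Suc n + real n * b ^ Suc n"
proof (induction n)
  case (Suc n)
  have "0 \<le> (b - a) * (b ^ Suc n - a ^ Suc n)"
  proof (cases "a \<le> b")
    case True
    then show ?thesis using assms by (intro mult_nonneg_nonneg) (auto intro!: mult_mono power_mono)
  next
    case False
    then show ?thesis using assms by (intro mult_nonpos_nonpos) (auto intro!: mult_mono power_mono)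
  qed
  moreover have "b * ((real n + 1) * (a * b ^ n)) \<le> b * (a ^ Suc n + real n * b ^ Suc n)"
    using Suc assms by (intro mult_left_mono)
  ultimately show ?case by (simp add: algebra_simps)
qed simp

text \<open>Minkowski's inequality in the norm of exponent 2h for the Fourier transforms of the two
  indicator functions, obtained from the convexity of x^(2h) after dividing each by its norm. The
  norms are positive as the diagonal relations always count.\<close>

lemma root_add_energy_Un_le:
  assumes h: "0 < h" and fin: "finite S" "finite T" and disj: "S \<inter> T = {}"
  shows "root (2*h) (add_energy h (S \<union> T)) \<le> root (2*h) (add_energy h S) + root (2*h) (add_energy h T)"
proof (cases "S = {} \<or> T = {}")
  case True
  then show ?thesis using h by auto
next
  case False
  obtain M where M: "2 * int h * (\<Sum>a\<in>S \<union> T. \<bar>a\<bar>) < int M" using ex_modulus by blast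
  have M0: "0 < M" using modulus_pos[OF M] .
  define F where "F = (\<lambda>S t. cmod (fourier M S (\<lambda>_. 1) t))"
  have eq: "real (add_energy h U) = (\<Sum>t<M. F U t ^ (2 * h)) / M" if "U \<subseteq> S \<union> T" for U
  proof -
    have "finite U" using that fin by (meson finite_UnI finite_subset)
    then show ?thesis
      using weighted_energy_eq_fourier[OF _ modulus_mono[OF _ that M], of "\<lambda>_. 1"] fin
      by (simp add: add_energy_eq F_def)
  qed
  have pos: "0 < real (add_energy h U)" if U: "U \<noteq> {}" "finite U" for U
  proof -
    obtain u where "u \<in> U" using U by auto
    then have "(\<lambda>i\<in>{0..<2*h}. u) \<in> add_solutions h U"
      by (auto simp: add_solutions_def)
    then show ?thesis using finite_add_solutions[OF U(2), of h]
      by (auto simp: add_energy_def add_solutions_def[symmetric] card_gt_0_iff)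
  qed
  define A B where "A = root (2*h) (add_energy h S)" and "B = root (2*h) (add_energy h T)"
  have AB: "0 < A" "0 < B" using pos False fin h by (auto simp: A_def B_def)
  have Apow: "A ^ (2*h) = (\<Sum>t<M. F S t ^ (2 * h)) / M"
    using h eq[of S] by (simp add: A_def)
  have Bpow: "B ^ (2*h) = (\<Sum>t<M. F T t ^ (2 * h)) / M"
    using h eq[of T] by (simp add: B_def)
  define \<theta> where "\<theta> = A / (A + B)"
  have \<theta>: "0 \<le> \<theta>" "\<theta> \<le> 1" "1 - \<theta> = B / (A + B)" using AB by (auto simp: \<theta>_def field_simps)
  have "F (S \<union> T) t ^ (2*h) \<le> (A + B) ^ (2*h) * (\<theta> * (F S t ^ (2*h) / A ^ (2*h)) + (1 - \<theta>) * (F T t ^ (2*h) / B ^ (2*h)))" for t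
  proof -
    have "fourier M (S \<union> T) (\<lambda>_. 1) t = fourier M S (\<lambda>_. 1) t + fourier M T (\<lambda>_. 1) t"
      unfolding fourier_def using fin disj by (intro sum.union_disjoint)
    then have "F (S \<union> T) t \<le> F S t + F T t" unfolding F_def by (simp add: norm_triangle_ineq)
    also have "\<dots> = (A + B) * (\<theta> * (F S t / A) + (1 - \<theta>) * (F T t / B))"
    proof -
      have "A + B \<noteq> 0" using AB by simp
      then show ?thesis unfolding \<theta>(3) using AB by (simp add: \<theta>_def distrib_left)
    qed
    finally have "F (S \<union> T) t ^ (2*h) \<le> ((A + B) * (\<theta> * (F S t / A) + (1 - \<theta>) * (F T t / B))) ^ (2*h)"
      by (rule power_mono) (simp add: F_def)
    also have "\<dots> = (A + B) ^ (2*h) * (\<theta> * (F S t / A) + (1 - \<theta>) * (F T t / B)) ^ (2*h)"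
      by (rule power_mult_distrib)
    also have "\<dots> \<le> (A + B) ^ (2*h) * (\<theta> * (F S t / A) ^ (2*h) + (1 - \<theta>) * (F T t / B) ^ (2*h))"
      using convex_onD[OF convex_power_even[of "2*h"], of "1 - \<theta>" "F S t / A" "F T t / B"] \<theta>(1,2) AB
      by (intro mult_left_mono) auto
    finally show ?thesis by (simp add: power_divide)
  qed
  then have "(\<Sum>t<M. F (S \<union> T) t ^ (2*h)) / M \<le>
      (\<Sum>t<M. (A + B) ^ (2*h) * (\<theta> * (F S t ^ (2*h) / A ^ (2*h)) + (1 - \<theta>) * (F T t ^ (2*h) / B ^ (2*h)))) / M"
    by (intro divide_right_mono sum_mono) auto
  also have "\<dots> = (A + B) ^ (2*h) * (\<theta> * (((\<Sum>t<M. F S t ^ (2*h)) / M) / A ^ (2*h)) + (1 - \<theta>) * (((\<Sum>t<M. F T t ^ (2*h)) / M) / B ^ (2*h)))"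
    by (simp add: sum_distrib_left sum_divide_distrib sum.distrib add_divide_distrib ring_distribs mult_ac)
  also have "\<dots> = (A + B) ^ (2*h)" unfolding Apow[symmetric] Bpow[symmetric] using AB by simp
  finally have "real (add_energy h (S \<union> T)) \<le> (A + B) ^ (2*h)" using eq[of "S \<union> T"] by simp
  then have "root (2*h) (add_energy h (S \<union> T)) \<le> root (2*h) ((A + B) ^ (2*h))"
    using h by (intro real_root_le_mono) auto
  also have "\<dots> = A + B" using h AB by (simp add: real_root_power_cancel)
  finally show ?thesis by (simp add: A_def B_def)
qed


section \<open>\<Lambda> constants and Chang's inequality\<close>

text \<open>L bounds the square of the \<Lambda>(2h) constant of S. Arbitrary weights rather than
  indicators let the bounds for fibres add up in square mean; nonnegative ones make the energy
  monotone in the set.\<close>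

definition Lambda_bound :: "nat \<Rightarrow> int set \<Rightarrow> real \<Rightarrow> bool" where
  "Lambda_bound h S L \<longleftrightarrow> (\<forall>w. (\<forall>a\<in>S. 0 \<le> w a) \<longrightarrow> weighted_energy h S w \<le> (L * (\<Sum>a\<in>S. (w a)\<^sup>2)) ^ h)"

lemma Lambda_boundD:
  "\<lbrakk>Lambda_bound h S L; \<And>a. a \<in> S \<Longrightarrow> 0 \<le> w a\<rbrakk> \<Longrightarrow> weighted_energy h S w \<le> (L * (\<Sum>a\<in>S. (w a)\<^sup>2)) ^ h"
  by (auto simp: Lambda_bound_def)

lemma Lambda_bound_mono:
  assumes "Lambda_bound h S L" "0 \<le> L" "L \<le> L'"
  shows "Lambda_bound h S L'"
  unfolding Lambda_bound_def
proof (intro allI impI)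
  fix w :: "int \<Rightarrow> real" assume w: "\<forall>a\<in>S. 0 \<le> w a"
  have "weighted_energy h S w \<le> (L * (\<Sum>a\<in>S. (w a)\<^sup>2)) ^ h"
    using assms w by (intro Lambda_boundD) auto
  also have "\<dots> \<le> (L' * (\<Sum>a\<in>S. (w a)\<^sup>2)) ^ h"
    using assms by (intro power_mono mult_right_mono) (auto intro!: mult_nonneg_nonneg sum_nonneg)
  finally show "weighted_energy h S w \<le> (L' * (\<Sum>a\<in>S. (w a)\<^sup>2)) ^ h" .
qed

lemma Lambda_bound_subset:
  assumes L: "Lambda_bound h S L" and fin: "finite S" and sub: "T \<subseteq> S"
  shows "Lambda_bound h T L"
  unfolding Lambda_bound_def
proof (intro allI impI)
  fix w :: "int \<Rightarrow> real" assume w: "\<forall>a\<in>T. 0 \<le> w a"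
  let ?w = "\<lambda>a. if a \<in> T then w a else 0"
  have "weighted_energy h T w = (\<Sum>x\<in>add_solutions h T. \<Prod>i\<in>{0..<2*h}. ?w (x i))"
    unfolding weighted_energy_def
    by (intro sum.cong prod.cong refl) (auto simp: add_solutions_def PiE_iff)
  also have "\<dots> \<le> weighted_energy h S ?w"
    unfolding weighted_energy_def using sub w finite_add_solutions[OF fin]
    by (intro sum_mono2) (auto simp: add_solutions_def PiE_iff intro!: prod_nonneg)
  also have "\<dots> \<le> (L * (\<Sum>a\<in>S. (?w a)\<^sup>2)) ^ h"
    using L w by (intro Lambda_boundD) auto
  also have "(\<Sum>a\<in>S. (?w a)\<^sup>2) = (\<Sum>a\<in>T. (?w a)\<^sup>2)"
    using fin sub by (intro sum.mono_neutral_right) auto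
  also have "\<dots> = (\<Sum>a\<in>T. (w a)\<^sup>2)" by simp
  finally show "weighted_energy h T w \<le> (L * (\<Sum>a\<in>T. (w a)\<^sup>2)) ^ h" .
qed

lemma Lambda_bound_dilate:
  assumes L: "Lambda_bound h S L" and fin: "finite S" and t: "t \<noteq> 0" and sub: "\<And>a. a \<in> T \<Longrightarrow> t * a \<in> S"
  shows "Lambda_bound h T L"
  unfolding Lambda_bound_def
proof (intro allI impI)
  fix w :: "int \<Rightarrow> real" assume w: "\<forall>a\<in>T. 0 \<le> w a"
  let ?T = "(*) t ` T" and ?w = "\<lambda>b. w (b div t)"
  have "?T \<subseteq> S" using sub by auto
  then have LT: "Lambda_bound h ?T L" and finT: "finite ?T"
    using Lambda_bound_subset[OF L fin] fin finite_subset by auto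
  let ?e = "\<lambda>x. \<lambda>i\<in>{0..<2*h}. t * x i"
  have inj: "inj_on ?e (add_solutions h T)"
  proof (rule inj_onI)
    fix x y assume x: "x \<in> add_solutions h T" and y: "y \<in> add_solutions h T" and eq: "?e x = ?e y"
    show "x = y"
    proof (rule PiE_ext)
      show "x \<in> {0..<2*h} \<rightarrow>\<^sub>E T" "y \<in> {0..<2*h} \<rightarrow>\<^sub>E T" using x y by (auto simp: add_solutions_def)
      show "x i = y i" if "i \<in> {0..<2*h}" for i
        using fun_cong[OF eq, of i] that t by simp
    qed
  qed
  have sub: "?e ` add_solutions h T \<subseteq> add_solutions h ?T"
    by (auto simp: add_solutions_def PiE_iff simp flip: sum_distrib_left)
  have "weighted_energy h T w = (\<Sum>y\<in>?e ` add_solutions h T. \<Prod>i\<in>{0..<2*h}. ?w (y i))"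
    unfolding weighted_energy_def sum.reindex[OF inj] comp_def
    using t by (intro sum.cong prod.cong refl) simp
  also have "\<dots> \<le> weighted_energy h ?T ?w"
    unfolding weighted_energy_def using sub w finite_add_solutions[OF finT] t
    by (intro sum_mono2) (auto simp: add_solutions_def PiE_iff intro!: prod_nonneg)
  also have "\<dots> \<le> (L * (\<Sum>b\<in>?T. (?w b)\<^sup>2)) ^ h"
    using LT w t by (intro Lambda_boundD) auto
  also have "(\<Sum>b\<in>?T. (?w b)\<^sup>2) = (\<Sum>a\<in>T. (w a)\<^sup>2)"
    using t by (subst sum.reindex) (auto simp: inj_on_def)
  finally show "weighted_energy h T w \<le> (L * (\<Sum>a\<in>T. (w a)\<^sup>2)) ^ h" .
qed

lemma Lambda_bound_singleton: "Lambda_bound h {a} 1"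
  unfolding Lambda_bound_def
proof (intro allI impI)
  fix w :: "int \<Rightarrow> real"
  have "weighted_energy h {a} w \<le> (\<Sum>x\<in>{0..<2*h} \<rightarrow>\<^sub>E {a}. (w a) ^ (2 * h))"
  proof -
    have "weighted_energy h {a} w = (\<Sum>x\<in>add_solutions h {a}. (w a) ^ (2 * h))"
      unfolding weighted_energy_def
      by (intro sum.cong refl) (auto simp: add_solutions_def PiE_iff)
    also have "\<dots> \<le> (\<Sum>x\<in>{0..<2*h} \<rightarrow>\<^sub>E {a}. (w a) ^ (2 * h))"
      by (intro sum_mono2 finite_PiE) (auto simp: add_solutions_def)
    finally show ?thesis .
  qed
  also have "\<dots> = (1 * (\<Sum>a\<in>{a}. (w a)\<^sup>2)) ^ h"
    by (simp add: card_PiE power_mult)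
  finally show "weighted_energy h {a} w \<le> (1 * (\<Sum>a\<in>{a}. (w a)\<^sup>2)) ^ h" .
qed

text \<open>Were the least valuation attained once only, that term would be divisible by a further
  power of p, being minus the sum of the others. The value 0 is excluded because
  \<open>multiplicity\<close> assigns it 0 instead of infinity.\<close>

lemma add_solution_equal_multiplicities:
  fixes p :: int
  assumes h: "0 < h" and p: "prime p" and S: "0 \<notin> S" and x: "x \<in> add_solutions h S"
  obtains a b where "a < 2*h" "b < 2*h" "a \<noteq> b" "multiplicity p (x a) = multiplicity p (x b)"
proof -
  let ?I = "{0..<2*h}" and ?v = "\<lambda>i. multiplicity p (x i)"
  have xS: "x i \<in> S" if "i \<in> ?I" for i using x that by (auto simp: add_solutions_def PiE_iff)
  have nz: "x i \<noteq> 0" if "i \<in> ?I" for i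
  proof
    assume "x i = 0"
    with xS[OF that] S show False by simp
  qed
  have unit: "\<not> is_unit p" by (rule prime_elem_not_unit[OF prime_imp_prime_elem[OF p]])
  have "finite (?v ` ?I)" "?v ` ?I \<noteq> {}" using h by auto
  then have "Min (?v ` ?I) \<in> ?v ` ?I" by (rule Min_in)
  then obtain a where a: "a \<in> ?I" "Min (?v ` ?I) = ?v a" by blast
  have min: "?v a \<le> ?v i" if "i \<in> ?I" for i unfolding a(2)[symmetric] using that by (intro Min_le) auto
  have "\<exists>b\<in>?I - {a}. ?v b = ?v a"
  proof (rule ccontr)
    assume "\<not> ?thesis"
    then have ne: "?v i \<noteq> ?v a" if "i \<in> ?I - {a}" for i using that by blast
    have "Suc (?v a) \<le> ?v i" if "i \<in> ?I - {a}" for i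
    proof -
      have "?v a \<le> ?v i" using that by (intro min) auto
      then show ?thesis using ne[OF that] by linarith
    qed
    then have "p ^ Suc (?v a) dvd x i" if "i \<in> ?I - {a}" for i
      using that by (intro multiplicity_dvd') auto
    then have "p ^ Suc (?v a) dvd (\<Sum>i\<in>?I - {a}. side h i * x i)"
      by (intro dvd_sum dvd_mult) auto
    moreover have "side h a * x a + (\<Sum>i\<in>?I - {a}. side h i * x i) = 0"
      using x a by (simp add: add_solutions_iff sum.remove)
    then have "side h a * x a = - (\<Sum>i\<in>?I - {a}. side h i * x i)" by linarith
    ultimately have "p ^ Suc (?v a) dvd side h a * x a" by (simp only: dvd_minus_iff)
    then have "p ^ Suc (?v a) dvd x a" by (auto simp: side_def split: if_splits)
    then have "Suc (?v a) \<le> ?v a"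
      using nz[OF a(1)] unit power_dvd_iff_le_multiplicity[of "x a" p "Suc (?v a)"] by simp
    then show False by simp
  qed
  then obtain b where "b \<in> ?I - {a}" "?v b = ?v a" by blast
  then show ?thesis using a(1) by (intro that[of a b]) auto
qed

text \<open>Chang's inequality: in an additive relation the least \<open>p\<close>-adic valuation occurs twice, so a
  partition by valuation behaves like a sequence of martingale differences.\<close>

lemma Lambda_bound_valuation_partition:
  fixes p :: int
  assumes h: "0 < h" and p: "prime p" and fin: "finite S" and S: "0 \<notin> S" and L: "0 \<le> L"
    and fibre: "\<And>j. Lambda_bound h {a\<in>S. multiplicity p a = j} L"
  shows "Lambda_bound h S ((2 * real h)\<^sup>2 * L)"
  unfolding Lambda_bound_def
proof (intro allI impI)
  fix w :: "int \<Rightarrow> real" assume w: "\<forall>a\<in>S. 0 \<le> w a"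
  let ?v = "multiplicity p"
  define J where "J = ?v ` S"
  define Sj where "Sj = (\<lambda>j. {a\<in>S. ?v a = j})"
  define wj where "wj = (\<lambda>j a. if ?v a = j then w a else 0)"
  define W where "W = (\<lambda>j. \<Sum>a\<in>Sj j. (w a)\<^sup>2)"
  obtain n where n: "h = Suc n" using h gr0_implies_Suc by auto
  obtain M where M: "2 * int h * (\<Sum>a\<in>S. \<bar>a\<bar>) < int M" using ex_modulus by blast
  have M0: "0 < M" using modulus_pos[OF M] .
  define F where "F = (\<lambda>t. cmod (fourier M S w t))"
  define f where "f = (\<lambda>j t. cmod (fourier M S (wj j) t))"
  define X where "X = weighted_energy h S w"
  have F0: "0 \<le> F t" and f0: "0 \<le> f j t" for t j by (auto simp: F_def f_def)
  have finJ: "finite J" using fin by (simp add: J_def)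
  have X0: "0 \<le> X" unfolding X_def using w by (intro weighted_energy_nonneg) auto
  have XF: "X = (\<Sum>t<M. F t ^ (2*h)) / M"
    unfolding X_def F_def by (rule weighted_energy_eq_fourier[OF fin M])
  have W0: "0 \<le> W j" for j by (auto simp: W_def intro!: sum_nonneg)
  have sumW: "(\<Sum>j\<in>J. W j) = (\<Sum>a\<in>S. (w a)\<^sup>2)"
    unfolding W_def Sj_def J_def using sum.image_gen[OF fin, of "\<lambda>a. (w a)\<^sup>2" ?v] by simp
  have Yj: "(\<Sum>t<M. f j t ^ (2*h)) / M \<le> (L * W j) ^ h" for j
  proof -
    have sub: "Sj j \<subseteq> S" and finSj: "finite (Sj j)" using fin by (auto simp: Sj_def)
    have "fourier M S (wj j) t = fourier M (Sj j) w t" for t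
      unfolding fourier_def Sj_def wj_def using fin
      by (auto simp: sum.inter_filter intro!: sum.cong)
    then have "(\<Sum>t<M. f j t ^ (2*h)) / M = weighted_energy h (Sj j) w"
      unfolding f_def using weighted_energy_eq_fourier[OF finSj modulus_mono[OF fin sub M]] by simp
    also have "\<dots> \<le> (L * W j) ^ h"
      unfolding W_def using fibre[of j] w by (intro Lambda_boundD) (auto simp: Sj_def)
    finally show ?thesis .
  qed
  \<comment> \<open>A union bound over the two positions with equal valuation and over this
    valuation j; overcounting is harmless since the weights are nonnegative. The (2h)^2 choices of
    positions are the loss in the statement.\<close>
  have pair: "X \<le> (\<Sum>a<2*h. \<Sum>b<2*h. \<Sum>j\<in>J. (\<Sum>t<M. (f j t)\<^sup>2 * F t ^ (2*n)) / M)"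
  proof -
    let ?g = "\<lambda>a b j x. \<Prod>i\<in>{0..<2*h}. (if i = a \<or> i = b then wj j else w) (x i)"
    have g0: "0 \<le> ?g a b j x" if "x \<in> add_solutions h S" for a b j x
      using that w by (intro prod_nonneg) (auto simp: add_solutions_def PiE_iff wj_def)
    have "X \<le> (\<Sum>x\<in>add_solutions h S. \<Sum>a<2*h. \<Sum>b<2*h. \<Sum>j\<in>J. if a = b then 0 else ?g a b j x)"
      unfolding X_def weighted_energy_def
    proof (rule sum_mono)
      fix x assume x: "x \<in> add_solutions h S"
      obtain a b where ab: "a < 2*h" "b < 2*h" "a \<noteq> b" "?v (x a) = ?v (x b)"
        using add_solution_equal_multiplicities[OF h p S x] by blast
      let ?j = "?v (x a)"
      have jJ: "?j \<in> J" using x ab by (auto simp: J_def add_solutions_def PiE_iff)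
      have "(\<Prod>i\<in>{0..<2*h}. w (x i)) = ?g a b ?j x"
        using ab by (intro prod.cong refl) (auto simp: wj_def)
      also have "\<dots> = (if a = b then 0 else ?g a b ?j x)" using ab by simp
      also have "\<dots> \<le> (\<Sum>j\<in>J. if a = b then 0 else ?g a b j x)"
        using jJ finJ g0[OF x] by (intro member_le_sum) auto
      also have "\<dots> \<le> (\<Sum>b<2*h. \<Sum>j\<in>J. if a = b then 0 else ?g a b j x)"
        using ab g0[OF x] by (intro member_le_sum[of b "{..<2*h}" "\<lambda>b. \<Sum>j\<in>J. if a = b then 0 else ?g a b j x"]) (auto intro!: sum_nonneg)
      also have "\<dots> \<le> (\<Sum>a<2*h. \<Sum>b<2*h. \<Sum>j\<in>J. if a = b then 0 else ?g a b j x)"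
        using ab g0[OF x] by (intro member_le_sum[of a "{..<2*h}" "\<lambda>a. \<Sum>b<2*h. \<Sum>j\<in>J. if a = b then 0 else ?g a b j x"]) (auto intro!: sum_nonneg)
      finally show "(\<Prod>i\<in>{0..<2*h}. w (x i)) \<le> \<dots>" .
    qed
    also have "\<dots> = (\<Sum>a<2*h. \<Sum>b<2*h. \<Sum>j\<in>J. \<Sum>x\<in>add_solutions h S. if a = b then 0 else ?g a b j x)"
      by (subst sum.swap, rule sum.cong[OF refl], subst sum.swap, rule sum.cong[OF refl], rule sum.swap)
    also have "\<dots> \<le> (\<Sum>a<2*h. \<Sum>b<2*h. \<Sum>j\<in>J. (\<Sum>t<M. (f j t)\<^sup>2 * F t ^ (2*n)) / M)"
    proof (intro sum_mono)
      fix a b j assume ab: "a \<in> {..<2*h}" "b \<in> {..<2*h}"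
      show "(\<Sum>x\<in>add_solutions h S. if a = b then 0 else ?g a b j x) \<le> (\<Sum>t<M. (f j t)\<^sup>2 * F t ^ (2*n)) / M"
      proof (cases "a = b")
        case True
        then show ?thesis using F0 by (auto intro!: divide_nonneg_nonneg sum_nonneg)
      next
        case False
        have eq: "(\<Prod>i\<in>{0..<2*h}. cmod (fourier M S (if i = a \<or> i = b then wj j else w) t)) = (f j t)\<^sup>2 * F t ^ (2*n)" for t
        proof -
          have "{0..<2*h} = insert a (insert b ({0..<2*h} - {a,b}))" using ab by auto
          then have "(\<Prod>i\<in>{0..<2*h}. cmod (fourier M S (if i = a \<or> i = b then wj j else w) t))
             = (\<Prod>i\<in>insert a (insert b ({0..<2*h} - {a,b})). cmod (fourier M S (if i = a \<or> i = b then wj j else w) t))"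
            by simp
          also have "\<dots> = f j t * (f j t * (\<Prod>i\<in>{0..<2*h} - {a,b}. F t))"
            using False by (auto simp: f_def F_def intro!: prod.cong)
          also have "card ({0..<2*h} - {a,b}) = 2 * n"
            using ab False n by (subst card_Diff_subset) auto
          then have "(\<Prod>i\<in>{0..<2*h} - {a,b}. F t) = F t ^ (2*n)" by simp
          finally show ?thesis by (simp add: power2_eq_square mult.assoc)
        qed
        have "(\<Sum>x\<in>add_solutions h S. ?g a b j x)
            \<le> (\<Sum>t<M. \<Prod>i\<in>{0..<2*h}. cmod (fourier M S (if i = a \<or> i = b then wj j else w) t)) / M"
          by (rule sum_add_solutions_le[OF fin M])
        then show ?thesis using False unfolding eq by simp
      qed
    qed
    finally show ?thesis .
  qed
  show "weighted_energy h S w \<le> ((2 * real h)\<^sup>2 * L * (\<Sum>a\<in>S. (w a)\<^sup>2)) ^ h"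
  proof (cases "X = 0")
    case True
    then show ?thesis using L by (simp add: X_def[symmetric] sum_nonneg)
  next
    case False
    \<comment> \<open>Z is the squared norm of exponent 2h. It remains to bound Z^(n+1) by Z^n times
      the asserted bound and to cancel.\<close>
    define Z where "Z = root h X"
    have Z: "0 < Z" "Z ^ h = X" using False X0 h by (auto simp: Z_def)
    \<comment> \<open>Hoelder with exponents h and h/(h - 1), through AM-GM after dividing by the
      two norms; a vanishing fibre bound is treated apart because it becomes a divisor.\<close>
    have hol: "(\<Sum>t<M. (f j t)\<^sup>2 * F t ^ (2*n)) / M \<le> L * W j * Z ^ n" for j
    proof (cases "L * W j = 0")
      case True
      have "(\<Sum>t<M. f j t ^ (2*h)) / M \<le> 0" using Yj[of j] h unfolding True by (simp add: zero_power)
      then have "(\<Sum>t<M. f j t ^ (2*h)) \<le> 0" using M0 by (simp add: divide_le_0_iff)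
      moreover have "0 \<le> (\<Sum>t<M. f j t ^ (2*h))" using f0 by (auto intro!: sum_nonneg)
      ultimately have "(\<Sum>t<M. f j t ^ (2*h)) = 0" by linarith
      then have "\<forall>t\<in>{..<M}. f j t ^ (2*h) = 0"
        using f0 by (subst (asm) sum_nonneg_eq_0_iff) auto
      then have "(\<Sum>t<M. (f j t)\<^sup>2 * F t ^ (2*n)) = 0" by (intro sum.neutral) auto
      then show ?thesis unfolding True by simp
    next
      case False
      define \<alpha> where "\<alpha> = L * W j"
      have \<alpha>: "0 < \<alpha>" using False L W0[of j] by (auto simp: \<alpha>_def zero_less_mult_iff less_le)
      have "real h * ((\<Sum>t<M. (f j t)\<^sup>2 * F t ^ (2*n)) / M) / (\<alpha> * Z ^ n)
          = (\<Sum>t<M. (real n + 1) * ((f j t)\<^sup>2 / \<alpha> * ((F t)\<^sup>2 / Z) ^ n)) / M"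
      proof -
        have "(real n + 1) * ((f j t)\<^sup>2 / \<alpha> * ((F t)\<^sup>2 / Z) ^ n) = real h / (\<alpha> * Z ^ n) * ((f j t)\<^sup>2 * F t ^ (2*n))" for t
          by (simp add: n power_divide power_mult add.commute)
        then show ?thesis by (simp only: sum_distrib_left[symmetric]) simp
      qed
      also have "\<dots> \<le> (\<Sum>t<M. ((f j t)\<^sup>2 / \<alpha>) ^ h + real n * ((F t)\<^sup>2 / Z) ^ h) / M"
        unfolding n using \<alpha> Z by (intro divide_right_mono sum_mono weighted_AM_GM_power) auto
      also have "\<dots> = ((\<Sum>t<M. f j t ^ (2*h)) / M) / \<alpha> ^ h + real n * (((\<Sum>t<M. F t ^ (2*h)) / M) / Z ^ h)"
      proof -
        have "((f j t)\<^sup>2 / \<alpha>) ^ h + real n * ((F t)\<^sup>2 / Z) ^ h = f j t ^ (2*h) / \<alpha> ^ h + real n / Z ^ h * F t ^ (2*h)" for t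
          by (simp add: power_divide power_mult)
        then show ?thesis
          by (simp add: sum.distrib sum_distrib_left[symmetric] sum_divide_distrib[symmetric] add_divide_distrib mult.commute)
      qed
      also have "\<dots> \<le> 1 + real n * 1"
      proof -
        have "((\<Sum>t<M. f j t ^ (2*h)) / M) / \<alpha> ^ h \<le> 1"
          using Yj[of j] \<alpha> by (subst divide_le_eq_1_pos) (auto simp: \<alpha>_def)
        moreover have "((\<Sum>t<M. F t ^ (2*h)) / M) / Z ^ h = 1"
          unfolding XF[symmetric] Z(2) using \<open>X \<noteq> 0\<close> by simp
        ultimately show ?thesis by simp
      qed
      finally have "real h * (((\<Sum>t<M. (f j t)\<^sup>2 * F t ^ (2*n)) / M) / (\<alpha> * Z ^ n)) \<le> real h * 1"
        by (simp add: n)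
      then have "((\<Sum>t<M. (f j t)\<^sup>2 * F t ^ (2*n)) / M) / (\<alpha> * Z ^ n) \<le> 1"
        using h by (simp only: mult_le_cancel_left_pos of_nat_0_less_iff)
      moreover have "0 < \<alpha> * Z ^ n" using \<alpha> Z(1) by simp
      ultimately have "(\<Sum>t<M. (f j t)\<^sup>2 * F t ^ (2*n)) / M \<le> 1 * (\<alpha> * Z ^ n)"
        by (simp only: pos_divide_le_eq)
      then show ?thesis by (simp add: \<alpha>_def)
    qed
    have "X \<le> (\<Sum>a<2*h. \<Sum>b<2*h. \<Sum>j\<in>J. L * W j * Z ^ n)"
      by (rule order_trans[OF pair]) (intro sum_mono hol)
    also have "\<dots> = (2 * real h)\<^sup>2 * L * (\<Sum>a\<in>S. (w a)\<^sup>2) * Z ^ n"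
      unfolding sum_distrib_right[symmetric] sum_distrib_left[symmetric] sumW
      by (simp add: power2_eq_square mult_ac)
    finally have "Z * Z ^ n \<le> (2 * real h)\<^sup>2 * L * (\<Sum>a\<in>S. (w a)\<^sup>2) * Z ^ n"
      using Z(2) n by simp
    then have "Z \<le> (2 * real h)\<^sup>2 * L * (\<Sum>a\<in>S. (w a)\<^sup>2)" using Z by simp
    then have "Z ^ h \<le> ((2 * real h)\<^sup>2 * L * (\<Sum>a\<in>S. (w a)\<^sup>2)) ^ h"
      using Z by (intro power_mono) auto
    then show ?thesis using Z by (simp add: X_def)
  qed
qed

section \<open>Functions with large multiplicative energy\<close>

definition mult_energy_cube :: "(int \<Rightarrow> real) \<Rightarrow> int set \<Rightarrow> real" where
  "mult_energy_cube r A = energy (\<lambda>a. ln (real_of_int a)) (\<lambda>a. r a ^ 3) A"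

text \<open>The number of steps of size \<open>step_size\<close> in the logarithm of Chang's factor
  \<open>(2 * h) ^ 2\<close>.\<close>

definition depth_exp :: "nat \<Rightarrow> real" where
  "depth_exp h = 2 * ln (2 * real h) / step_size"

lemma depth_exp_nonneg:
  assumes "0 < h"
  shows "0 \<le> depth_exp h"
proof -
  have "0 \<le> ln (2 * real h)" using assms by (intro ln_ge_zero) simp
  then show ?thesis using step_size_pos by (simp add: depth_exp_def)
qed

lemma exp_step_size_powr_depth:
  assumes "0 < h"
  shows "exp step_size powr (- depth_exp h) = 1 / (2 * real h)\<^sup>2"
proof -
  have "exp step_size powr (- depth_exp h) = exp (- (2 * ln (2 * real h)))"
    using step_size_pos by (simp add: powr_def depth_exp_def)
  also have "\<dots> = inverse (exp (ln (2 * real h)) * exp (ln (2 * real h)))"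
    by (simp only: exp_minus mult_2[of "ln _"] exp_add)
  also have "\<dots> = 1 / (2 * real h)\<^sup>2"
    using assms by (simp only: exp_ln_iff[THEN iffD2] power2_eq_square inverse_eq_divide)
  finally show ?thesis .
qed

lemma inj_on_ln_int: "A \<subseteq> {0<..} \<Longrightarrow> inj_on (\<lambda>a. ln (real_of_int a)) A"
  by (rule inj_onI) (auto simp: subset_iff)

lemma ln_int_sum_eq_iff:
  assumes "0 < a" "0 < b" "0 < c" "0 < d"
  shows "ln (real_of_int a) + ln (real_of_int b) = ln (real_of_int c) + ln (real_of_int d) \<longleftrightarrow> a * b = c * d"
proof -
  have "ln (real_of_int a) + ln (real_of_int b) = ln (real_of_int c) + ln (real_of_int d)
      \<longleftrightarrow> ln (real_of_int (a * b)) = ln (real_of_int (c * d))"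
    using assms by (simp add: ln_mult)
  also have "\<dots> \<longleftrightarrow> real_of_int (a * b) = real_of_int (c * d)"
    using assms by (intro ln_inj_iff) (simp_all flip: of_int_mult)
  finally show ?thesis by (simp only: of_int_eq_iff)
qed

lemma mult_energy_cube_pos:
  assumes "finite A" "A \<noteq> {}" "\<And>a. a \<in> A \<Longrightarrow> 0 < r a"
  shows "0 < mult_energy_cube r A"
proof -
  obtain a where a: "a \<in> A" using assms by auto
  let ?t = "\<lambda>a b c d. if ln (real_of_int a) + ln (real_of_int b) = ln (real_of_int c) + ln (real_of_int d)
    then r a ^ 3 * r b ^ 3 * r c ^ 3 * r d ^ 3 else 0"
  have t: "0 \<le> ?t a b c d" if "a \<in> A" "b \<in> A" "c \<in> A" "d \<in> A" for a b c d
    using that assms(3) by (simp add: less_imp_le)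
  have "0 < ?t a a a a" using assms(3)[OF a] by simp
  also have "\<dots> \<le> (\<Sum>d\<in>A. ?t a a a d)"
    by (rule member_le_sum[OF a t assms(1)]) (use a in auto)
  also have "\<dots> \<le> (\<Sum>c\<in>A. \<Sum>d\<in>A. ?t a a c d)"
    by (rule member_le_sum[OF a sum_nonneg[OF t] assms(1)]) (use a in auto)
  also have "\<dots> \<le> (\<Sum>b\<in>A. \<Sum>c\<in>A. \<Sum>d\<in>A. ?t a b c d)"
    by (rule member_le_sum[OF a sum_nonneg[OF sum_nonneg[OF t]] assms(1)]) (use a in auto)
  also have "\<dots> \<le> (\<Sum>a\<in>A. \<Sum>b\<in>A. \<Sum>c\<in>A. \<Sum>d\<in>A. ?t a b c d)"
    by (rule member_le_sum[OF a sum_nonneg[OF sum_nonneg[OF sum_nonneg[OF t]]] assms(1)]) (use a in auto)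
  finally show ?thesis unfolding mult_energy_cube_def quad_def .
qed

text \<open>Either a single fibre of the \<open>p\<close>-adic valuation contains the required subset, or the fibres whose
  normalised energy exceeds that of \<open>A\<close> by the factor \<open>exp step_size\<close> together carry enough mass;
  in the latter case this factor pays for the loss in Chang's inequality, by the choice of \<open>depth_exp\<close>.\<close>

lemma large_subset_with_Lambda_bound:
  fixes Ps :: "int set"
  assumes "finite Ps" and h: "0 < h"
    and "finite A" "A \<noteq> {}" "A \<subseteq> {0<..}" "\<And>a. a \<in> A \<Longrightarrow> 0 < r a" "\<And>p. p \<in> Ps \<Longrightarrow> prime p"
    and "\<And>p a b. \<lbrakk>prime p; p \<notin> Ps; a \<in> A; b \<in> A\<rbrakk> \<Longrightarrow> multiplicity p a = multiplicity p b"
  defines "eta \<equiv> \<lambda>A. root 3 (mult_energy_cube r A) / (\<Sum>a\<in>A. r a ^ 4)"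
  shows "\<exists>B\<subseteq>A. eta A powr loss_exp * (\<Sum>a\<in>A. r a ^ 4) \<le> (\<Sum>a\<in>B. r a ^ 4) \<and>
    Lambda_bound h B (eta A powr (- depth_exp h))"
  using assms(1,3-8)
proof (induction Ps arbitrary: A rule: finite_induct)
  case empty
  obtain a where a: "a \<in> A" using empty.prems(2) by auto
  \<comment> \<open>With no primes left, all valuations agree, and positive integers with equal
    valuations coincide.\<close>
  have "b = a" if "b \<in> A" for b
    using that a empty.prems(3) by (intro multiplicity_eq_int empty.prems(6)) auto
  then have A: "A = {a}" using a by blast
  have r: "0 < r a" using empty.prems(4) a by auto
  have "mult_energy_cube r A = (r a ^ 4) ^ 3"
    by (simp add: A mult_energy_cube_def quad_def flip: power_mult power_add)
  then have "root 3 (mult_energy_cube r A) = root 3 ((r a ^ 4) ^ 3)" by (rule arg_cong)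
  also have "\<dots> = r a ^ 4" by (rule odd_real_root_power_cancel) simp
  finally have root: "root 3 (mult_energy_cube r A) = r a ^ 4" .
  have sum: "(\<Sum>a\<in>A. r a ^ 4) = r a ^ 4" unfolding A by simp
  have "r a ^ 4 \<noteq> 0" using r by simp
  then have "eta A = 1" unfolding eta_def root sum by (rule divide_self)
  then have "eta A powr loss_exp * (\<Sum>a\<in>A. r a ^ 4) \<le> (\<Sum>a\<in>A. r a ^ 4)"
    "Lambda_bound h A (eta A powr (- depth_exp h))"
    using Lambda_bound_singleton[of h a] unfolding \<open>eta A = 1\<close> by (simp_all only: A powr_one_eq_one mult_1 order_refl)
  then show ?case by blast
next
  case (insert p Ps)
  have p: "prime p" using insert.prems(5) by auto
  define v where "v = (\<lambda>a::int. int (multiplicity p a))"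
  define S where "S = (\<lambda>i. {a\<in>A. v a = i})"
  define I where "I = v ` A"
  define m where "m = (\<Sum>a\<in>A. r a ^ 4)"
  define mi where "mi = (\<lambda>i. \<Sum>a\<in>S i. r a ^ 4)"
  have finS: "finite (S i)" and subS: "S i \<subseteq> A" for i using insert.prems(1-5) by (auto simp: S_def)
  have neS: "S i \<noteq> {}" if "i \<in> I" for i using that by (auto simp: S_def I_def)
  have finI: "finite I" using insert.prems(1-5) by (simp add: I_def)
  have rpos: "0 < r a ^ 4" if "a \<in> A" for a using insert.prems(4)[OF that] by simp
  have m: "0 < m" unfolding m_def by (rule sum_pos[OF insert.prems(1,2) rpos])
  have mi: "0 < mi i" if "i \<in> I" for i
    unfolding mi_def by (rule sum_pos[OF finS neS[OF that] rpos[OF subsetD[OF subS]]])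
  have sum_mi: "sum mi I = m"
    unfolding mi_def m_def I_def S_def
    using sum.image_gen[OF insert.prems(1), of "\<lambda>a. r a ^ 4" v] by simp
  have E: "0 < mult_energy_cube r A" by (rule mult_energy_cube_pos[OF insert.prems(1,2,4)])
  have Ei: "0 < mult_energy_cube r (S i)" if "i \<in> I" for i
    by (rule mult_energy_cube_pos[OF finS neS[OF that] insert.prems(4)[OF subsetD[OF subS]]])
  have eta: "0 < eta A" using E m by (simp add: eta_def m_def)
  have etai: "0 < eta (S i)" if "i \<in> I" for i using Ei[OF that] mi[OF that] by (simp add: eta_def mi_def)
  \<comment> \<open>Within a fibre the valuations at p agree as well, so p can leave the set of
    primes.\<close>
  have IH: "\<exists>B\<subseteq>S i. eta (S i) powr loss_exp * mi i \<le> (\<Sum>a\<in>B. r a ^ 4) \<and>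
      Lambda_bound h B (eta (S i) powr (- depth_exp h))" if "i \<in> I" for i
    unfolding mi_def
  proof (rule insert.IH)
    show "multiplicity p' a = multiplicity p' b" if "prime p'" "p' \<notin> Ps" "a \<in> S i" "b \<in> S i" for p' a b
      using that insert.prems(6)[of p' a b] by (cases "p' = p") (auto simp: S_def v_def)
    show "finite (S i)" "S i \<noteq> {}" "S i \<subseteq> {0<..}" using finS neS[OF that] subS insert.prems(3) by blast+
    show "0 < r a" if "a \<in> S i" for a by (rule insert.prems(4)[OF subsetD[OF subS that]])
    show "prime p'" if "p' \<in> Ps" for p' using that by (intro insert.prems(5)) blast
  qed
  define \<alpha> where "\<alpha> = (\<lambda>i. mi i / m)"
  define \<eta> where "\<eta> = (\<lambda>i. eta (S i) / eta A)"
  \<comment> \<open>The twelfth root makes both \<rho>^3, the fourth root of the relative energy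
    used for fibre energies, and \<rho>^4, its cube root \<eta> \<alpha>, integral powers.\<close>
  define \<rho> where "\<rho> = (\<lambda>i. root 12 (mult_energy_cube r (S i) / mult_energy_cube r A))"
  have "(\<exists>i\<in>I. 1 \<le> \<eta> i powr loss_exp * \<alpha> i) \<or>
      1 \<le> (\<Sum>i\<in>{i\<in>I. exp step_size \<le> \<eta> i}. \<eta> i powr loss_exp * \<alpha> i)"
  proof (rule fibre_dichotomy[OF finI, where r = \<rho>])
    show "0 < \<alpha> i" if "i \<in> I" for i using mi[OF that] m by (simp add: \<alpha>_def)
    show "sum \<alpha> I = 1" using m sum_mi by (simp add: \<alpha>_def flip: sum_divide_distrib)
    show "0 \<le> \<eta> i" if "i \<in> I" for i using etai[OF that] eta by (simp add: \<eta>_def)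
    show "0 \<le> \<rho> i" if "i \<in> I" for i using Ei[OF that] E by (simp add: \<rho>_def)
    show "\<rho> i ^ 4 = \<eta> i * \<alpha> i" if "i \<in> I" for i
    proof -
      let ?q = "mult_energy_cube r (S i) / mult_energy_cube r A"
      have q: "0 < ?q" using Ei[OF that] E by simp
      have "\<rho> i ^ 12 = ?q" unfolding \<rho>_def using q by simp
      then have "(\<rho> i ^ 4) ^ 3 = ?q" by (simp flip: power_mult)
      then have "\<rho> i ^ 4 = root 3 ?q" using q by (metis odd_numeral odd_real_root_power_cancel)
      also have "\<dots> = \<eta> i * \<alpha> i"
        using mi[OF that] m by (simp add: \<eta>_def \<alpha>_def eta_def real_root_divide mi_def m_def)
      finally show ?thesis .
    qed
    show "1 \<le> energy id (\<lambda>i. \<rho> i ^ 3) I"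
    proof -
      define c where "c = root 4 (mult_energy_cube r A)"
      have c: "0 < c" "c ^ 4 = mult_energy_cube r A" using E by (auto simp: c_def)
      define e where "e = (\<lambda>i. root 4 (mult_energy_cube r (S i)))"
      have e: "e i = c * \<rho> i ^ 3" if "i \<in> I" for i
      proof -
        let ?q = "mult_energy_cube r (S i) / mult_energy_cube r A"
        have q: "0 < ?q" using Ei[OF that] E by simp
        have "\<rho> i ^ 12 = ?q" unfolding \<rho>_def using q by simp
        then have "(\<rho> i ^ 3) ^ 4 = ?q" by (simp flip: power_mult)
        then have "root 4 ((\<rho> i ^ 3) ^ 4) = root 4 ?q" by (rule arg_cong)
        moreover have "0 \<le> \<rho> i ^ 3" using q by (simp add: \<rho>_def)
        then have "root 4 ((\<rho> i ^ 3) ^ 4) = \<rho> i ^ 3" by (intro real_root_power_cancel) simp_all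
        moreover have "root 4 ?q = e i / c" unfolding e_def c_def by (rule real_root_divide)
        ultimately have "e i / c = \<rho> i ^ 3" by simp
        then show ?thesis using c(1) by (simp add: divide_eq_eq mult.commute)
      qed
      have "c ^ 4 \<le> energy id e I"
        unfolding c(2) unfolding mult_energy_cube_def I_def
      proof (rule energy_le_fibre_energy)
        show "v a + v b = v c + v d"
          if "a \<in> A" "b \<in> A" "c \<in> A" "d \<in> A"
            "ln (real_of_int a) + ln (real_of_int b) = ln (real_of_int c) + ln (real_of_int d)" for a b c d
        proof -
          have pos: "0 < a" "0 < b" "0 < c" "0 < d" using subsetD[OF insert.prems(3) that(1)] subsetD[OF insert.prems(3) that(2)]
            subsetD[OF insert.prems(3) that(3)] subsetD[OF insert.prems(3) that(4)] by auto
          have "a * b = c * d" by (rule iffD1[OF ln_int_sum_eq_iff[OF pos] that(5)])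
          then have "multiplicity p (a * b) = multiplicity p (c * d)" by (rule arg_cong)
          moreover have "multiplicity p (x * y) = multiplicity p x + multiplicity p y"
            if "0 < x" "0 < y" for x y
            using that by (intro prime_elem_multiplicity_mult_distrib prime_imp_prime_elem p) auto
          ultimately have "multiplicity p a + multiplicity p b = multiplicity p c + multiplicity p d"
            using pos by metis
          then show ?thesis unfolding v_def of_nat_add[symmetric] by (rule arg_cong)
        qed
        show "e i ^ 4 = energy (\<lambda>a. ln (real_of_int a)) (\<lambda>a. r a ^ 3) {a \<in> A. v a = i}" if "i \<in> v ` A" for i
        proof -
          have "i \<in> I" using that by (simp add: I_def)
          then have "e i ^ 4 = mult_energy_cube r (S i)" using Ei by (simp add: e_def less_imp_le)
          then show ?thesis by (simp add: mult_energy_cube_def S_def)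
        qed
        show "0 \<le> e i" if "i \<in> v ` A" for i
          using Ei[of i] that by (simp add: e_def I_def less_imp_le)
        show "finite A" by (rule insert.prems(1))
        show "0 \<le> r a ^ 3" if "a \<in> A" for a using insert.prems(4)[OF that] by simp
      qed
      also have "energy id e I = c ^ 4 * energy id (\<lambda>i. \<rho> i ^ 3) I"
      proof -
        have "energy id e I = energy id (\<lambda>i. c * \<rho> i ^ 3) I"
          unfolding quad_def by (intro sum.cong refl) (simp add: e)
        also have "\<dots> = c ^ 4 * energy id (\<lambda>i. \<rho> i ^ 3) I"
          unfolding quad_def sum_distrib_left
          by (intro sum.cong refl) (simp add: power4_eq_xxxx)
        finally show ?thesis .
      qed
      finally show ?thesis using c(1) by simp
    qed
  qed
  then show ?case
  proof
    assume "\<exists>i\<in>I. 1 \<le> \<eta> i powr loss_exp * \<alpha> i"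
    then obtain i where i: "i \<in> I" "1 \<le> \<eta> i powr loss_exp * \<alpha> i" by auto
    obtain B where B: "B \<subseteq> S i" "eta (S i) powr loss_exp * mi i \<le> (\<Sum>a\<in>B. r a ^ 4)"
        "Lambda_bound h B (eta (S i) powr (- depth_exp h))"
      using IH[OF i(1)] by auto
    have big: "eta A powr loss_exp * m \<le> eta (S i) powr loss_exp * mi i"
      using i(2) etai[OF i(1)] eta m by (simp add: \<eta>_def \<alpha>_def powr_divide le_divide_eq)
    have "mi i \<le> m" unfolding sum_mi[symmetric] using finI i(1) mi by (intro member_le_sum) (auto simp: less_imp_le)
    then have "\<alpha> i \<le> 1" using m by (simp add: \<alpha>_def)
    \<comment> \<open>As the relative mass is at most 1, the condition on the fibre forces its
      normalised energy to be no smaller than that of A, so its \<Lambda> bound is good enough for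
      A.\<close>
    have "1 \<le> \<eta> i"
    proof (rule ccontr)
      assume "\<not> 1 \<le> \<eta> i"
      then have "\<eta> i powr loss_exp < 1 powr loss_exp"
        using etai[OF i(1)] eta loss_exp_ge by (intro powr_less_mono2) (auto simp: \<eta>_def)
      moreover have "0 < \<alpha> i" using mi[OF i(1)] m by (simp add: \<alpha>_def)
      ultimately have "\<eta> i powr loss_exp * \<alpha> i < 1 * 1"
        using \<open>\<alpha> i \<le> 1\<close> by (intro mult_less_le_imp_less) auto
      then show False using i(2) by simp
    qed
    then have "eta A \<le> eta (S i)" using eta by (simp add: \<eta>_def)
    then have "eta (S i) powr (- depth_exp h) \<le> eta A powr (- depth_exp h)"
      using eta depth_exp_nonneg[OF h] by (intro powr_mono2') auto
    then have "Lambda_bound h B (eta A powr (- depth_exp h))"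
      by (rule Lambda_bound_mono[OF B(3) powr_ge_zero])
    moreover have "eta A powr loss_exp * m \<le> (\<Sum>a\<in>B. r a ^ 4)" using big B(2) by linarith
    moreover have "B \<subseteq> A" using B(1) subS by blast
    ultimately show ?thesis unfolding m_def by blast
  next
    define G where "G = {i\<in>I. exp step_size \<le> \<eta> i}"
    assume "1 \<le> (\<Sum>i\<in>{i\<in>I. exp step_size \<le> \<eta> i}. \<eta> i powr loss_exp * \<alpha> i)"
    then have G: "1 \<le> (\<Sum>i\<in>G. \<eta> i powr loss_exp * \<alpha> i)" by (simp add: G_def)
    have GI: "G \<subseteq> I" and finG: "finite G" using finI by (auto simp: G_def)
    obtain Bi where Bi: "\<And>i. i \<in> I \<Longrightarrow> Bi i \<subseteq> S i"
        "\<And>i. i \<in> I \<Longrightarrow> eta (S i) powr loss_exp * mi i \<le> (\<Sum>a\<in>Bi i. r a ^ 4)"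
        "\<And>i. i \<in> I \<Longrightarrow> Lambda_bound h (Bi i) (eta (S i) powr (- depth_exp h))"
      using IH by metis
    define B where "B = (\<Union>i\<in>G. Bi i)"
    have BiS: "v a = i" if "i \<in> G" "a \<in> Bi i" for a i
      using subsetD[OF Bi(1)] that GI by (auto simp: S_def)
    have "Bi i \<subseteq> A" if "i \<in> G" for i
      using Bi(1) GI subS that by blast
    then have BA: "B \<subseteq> A" unfolding B_def by blast
    then have finB: "finite B" using insert.prems(1) finite_subset by blast
    have fibre: "{a\<in>B. v a = i} = (if i \<in> G then Bi i else {})" for i
      by (auto simp: B_def dest: BiS)
    have "eta A powr loss_exp * m \<le> eta A powr loss_exp * m * (\<Sum>i\<in>G. \<eta> i powr loss_exp * \<alpha> i)"
      using mult_left_mono[OF G, of "eta A powr loss_exp * m"] m by simp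
    also have "\<dots> = (\<Sum>i\<in>G. eta (S i) powr loss_exp * mi i)"
      unfolding sum_distrib_left
    proof (rule sum.cong[OF refl])
      fix i assume "i \<in> G"
      then have "0 < eta (S i)" using etai GI by blast
      then have "\<eta> i powr loss_exp = eta (S i) powr loss_exp / eta A powr loss_exp"
        unfolding \<eta>_def by (intro powr_divide)
      moreover have "eta A powr loss_exp \<noteq> 0" using eta by simp
      ultimately show "eta A powr loss_exp * m * (\<eta> i powr loss_exp * \<alpha> i) = eta (S i) powr loss_exp * mi i"
        unfolding \<alpha>_def using m by simp
    qed
    also have "\<dots> \<le> (\<Sum>i\<in>G. \<Sum>a\<in>Bi i. r a ^ 4)" 
      by (intro sum_mono Bi(2) subsetD[OF GI])
    also have "\<dots> = (\<Sum>i\<in>G. \<Sum>a\<in>{a\<in>B. v a = i}. r a ^ 4)"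
      by (intro sum.cong refl) (simp_all add: fibre)
    also have "\<dots> = (\<Sum>a\<in>B. r a ^ 4)"
      by (rule sum.group[OF finB finG]) (auto simp: B_def dest: BiS)
    finally have mass: "eta A powr loss_exp * m \<le> (\<Sum>a\<in>B. r a ^ 4)" .
    \<comment> \<open>All chosen fibres have normalised energy at least
      \<open>exp step_size * eta A\<close>, so this one constant serves them all.\<close>
    define L where "L = (exp step_size * eta A) powr (- depth_exp h)"
    have bound: "Lambda_bound h B ((2 * real h)\<^sup>2 * L)"
    proof (rule Lambda_bound_valuation_partition[OF h p finB])
      show "0 \<notin> B" using BA insert.prems(3) by auto
      show "0 \<le> L" by (simp add: L_def)
      show "Lambda_bound h {a\<in>B. multiplicity p a = j} L" for j
      proof (cases "int j \<in> G")
        case True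
        then have j: "int j \<in> I" "exp step_size * eta A \<le> eta (S (int j))"
          using eta by (auto simp: G_def \<eta>_def le_divide_eq)
        have eq: "{a\<in>B. multiplicity p a = j} = Bi (int j)"
          using fibre[of "int j"] True by (simp add: v_def)
        have "eta (S (int j)) powr (- depth_exp h) \<le> L"
          unfolding L_def using eta depth_exp_nonneg[OF h] j(2) by (intro powr_mono2') auto
        then show ?thesis unfolding eq by (rule Lambda_bound_mono[OF Bi(3)[OF j(1)] powr_ge_zero])
      next
        case False
        have eq: "{a\<in>B. multiplicity p a = j} = {}"
          using fibre[of "int j"] False by (simp add: v_def)
        have "{0..<2*h} \<rightarrow>\<^sub>E ({} :: int set) = {}"
          using h by (auto simp: PiE_eq_empty_iff intro!: exI[of _ 0])
        then have "add_solutions h {} = {}" by (simp add: add_solutions_def)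
        then have "weighted_energy h {} w = 0" for w by (simp only: weighted_energy_def sum.empty)
        then show ?thesis unfolding eq Lambda_bound_def using h by (simp only: sum.empty mult_zero_right zero_power order_refl simp_thms)
      qed
    qed
    have "(2 * real h)\<^sup>2 * L = eta A powr (- depth_exp h)"
    proof -
      have L: "L = 1 / (2 * real h)\<^sup>2 * eta A powr (- depth_exp h)"
        unfolding L_def powr_mult exp_step_size_powr_depth[OF h] by (rule refl)
      have "(2 * real h)\<^sup>2 * (1 / (2 * real h)\<^sup>2 * x) = x" for x using h by simp
      then show ?thesis unfolding L .
    qed
    with bound have "Lambda_bound h B (eta A powr (- depth_exp h))" by (simp only:)
    then show ?thesis using BA mass unfolding m_def by blast
  qed
qed

section \<open>From an energetic function to a large part of its support\<close>

text \<open>Log-convexity of the moments, as 4 = (2 * 3 + 6) / 3. For f = r^3 it bounds the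
  4/3-norm, in which the induction works, by the 1-norm and the 2-norm.\<close>

lemma sum_power_interpolation:
  fixes r :: "'a \<Rightarrow> real"
  assumes "\<And>a. a \<in> A \<Longrightarrow> 0 \<le> r a"
  shows "(\<Sum>a\<in>A. r a ^ 4) ^ 3 \<le> (\<Sum>a\<in>A. r a ^ 3)\<^sup>2 * (\<Sum>a\<in>A. r a ^ 6)"
proof -
  define p where "p = (\<lambda>n. \<Sum>a\<in>A. r a ^ n)"
  have p0: "0 \<le> p n" for n using assms by (auto simp: p_def intro!: sum_nonneg)
  have CS: "(p (i + j))\<^sup>2 \<le> p (2 * i) * p (2 * j)" for i j
    using Cauchy_Schwarz_ineq_sum[of "\<lambda>a. r a ^ i" "\<lambda>a. r a ^ j" A]
    by (simp add: p_def power_add power_mult mult.commute flip: power_mult)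
  \<comment> \<open>The exponents 3 and 5 are odd, so Cauchy-Schwarz is applied to powers of the
    square root of r.\<close>
  have CS': "(p 4)\<^sup>2 \<le> p 3 * p 5"
  proof -
    have "(\<Sum>a\<in>A. sqrt (r a) ^ 3 * sqrt (r a) ^ 5)\<^sup>2 \<le> (\<Sum>a\<in>A. (sqrt (r a) ^ 3)\<^sup>2) * (\<Sum>a\<in>A. (sqrt (r a) ^ 5)\<^sup>2)"
      by (rule Cauchy_Schwarz_ineq_sum)
    moreover have "sqrt (r a) ^ 3 * sqrt (r a) ^ 5 = r a ^ 4" "(sqrt (r a) ^ 3)\<^sup>2 = r a ^ 3"
        "(sqrt (r a) ^ 5)\<^sup>2 = r a ^ 5" if "a \<in> A" for a
    proof -
      have "sqrt (r a) ^ (2 * n) = r a ^ n" for n using assms[OF that] by (simp add: power_mult)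
      from this[of 4] this[of 3] this[of 5] show "sqrt (r a) ^ 3 * sqrt (r a) ^ 5 = r a ^ 4"
        "(sqrt (r a) ^ 3)\<^sup>2 = r a ^ 3" "(sqrt (r a) ^ 5)\<^sup>2 = r a ^ 5"
        by (simp_all flip: power_mult power_add)
    qed
    ultimately show ?thesis by (simp add: p_def)
  qed
  have "(p 5)\<^sup>2 \<le> p 4 * p 6" using CS[of 2 3] by simp
  have "p 4 * (p 4) ^ 3 = ((p 4)\<^sup>2)\<^sup>2" by (simp add: numeral_eq_Suc)
  also have "\<dots> \<le> (p 3 * p 5)\<^sup>2" by (intro power_mono CS') auto
  also have "\<dots> = (p 3)\<^sup>2 * (p 5)\<^sup>2" by (rule power_mult_distrib)
  also have "\<dots> \<le> (p 3)\<^sup>2 * (p 4 * p 6)" by (intro mult_left_mono \<open>(p 5)\<^sup>2 \<le> p 4 * p 6\<close>) auto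
  also have "\<dots> = p 4 * ((p 3)\<^sup>2 * p 6)" by simp
  finally have *: "p 4 * (p 4) ^ 3 \<le> p 4 * ((p 3)\<^sup>2 * p 6)" .
  have "p 4 ^ 3 \<le> (p 3)\<^sup>2 * p 6"
  proof (cases "p 4 = 0")
    case True
    then show ?thesis using p0[of 6] by simp
  next
    case False
    then have "0 < p 4" using p0[of 4] by simp
    then show ?thesis using * by (simp only: mult_le_cancel_left_pos)
  qed
  then show ?thesis unfolding p_def .
qed

text \<open>The hypothesis compares the energy with its trivial bound, the form in which the dyadic
  argument supplies it. Interpolation on X shows that Young's inequality is sharp up to K;
  interpolation on H turns its large sum of r^4 into a large sum of f.\<close>

lemma large_subset_of_energetic_function:
  fixes f :: "int \<Rightarrow> real"
  assumes h: "0 < h" and X: "finite X" "X \<noteq> {}" "X \<subseteq> {0<..}" and f: "\<And>a. a \<in> X \<Longrightarrow> 0 < f a"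
    and K: "1 \<le> K" and E: "(sum f X)\<^sup>2 * (\<Sum>a\<in>X. (f a)\<^sup>2) \<le> K * energy (\<lambda>a. ln (real_of_int a)) f X"
  shows "\<exists>H\<subseteq>X. K powr (- loss_exp) * sum f X \<le> sum f H \<and> Lambda_bound h H (K powr depth_exp h)"
proof -
  define r where "r = (\<lambda>a. root 3 (f a))"
  have r3: "r a ^ 3 = f a" for a by (simp add: r_def odd_real_root_pow)
  have r0: "0 < r a" if "a \<in> X" for a using f[OF that] by (simp add: r_def)
  have r6: "r a ^ 6 = (f a)\<^sup>2" for a by (simp flip: r3 power_mult)
  define En where "En = mult_energy_cube r X"
  define m where "m = (\<Sum>a\<in>X. r a ^ 4)"
  define \<theta> where "\<theta> = root 3 En / m"
  define Q where "Q = (\<Sum>a\<in>X. (f a)\<^sup>2)"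
  define F where "F = sum f X"
  have En: "En = energy (\<lambda>a. ln (real_of_int a)) f X" by (simp add: En_def mult_energy_cube_def r3)
  have En_pos: "0 < En" unfolding En_def by (rule mult_energy_cube_pos[OF X(1,2) r0])
  have m_pos: "0 < m" unfolding m_def by (rule sum_pos[OF X(1,2)]) (rule zero_less_power[OF r0])
  have Q_pos: "0 < Q" unfolding Q_def using X f by (intro sum_pos) (auto simp: less_le)
  have F_pos: "0 < F" unfolding F_def using X f by (intro sum_pos) auto
  have En_le: "En \<le> m ^ 3"
    unfolding En_def m_def mult_energy_cube_def by (rule energy_cube_le_cube_sum[OF X(1) inj_on_ln_int[OF X(3)]])
  have m_le: "m ^ 3 \<le> F\<^sup>2 * Q"
    using sum_power_interpolation[of X r] r0 unfolding m_def r3 r6 F_def Q_def by (simp add: less_imp_le)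
  have FQ: "F\<^sup>2 * Q \<le> K * En" using E by (simp add: F_def Q_def En)
  have \<theta>_pos: "0 < \<theta>" using En_pos m_pos by (simp add: \<theta>_def)
  have \<theta>3: "\<theta> ^ 3 = En / m ^ 3" by (simp add: \<theta>_def power_divide odd_real_root_pow)
  have \<theta>3_ge: "1 / K \<le> \<theta> ^ 3"
  proof -
    have "m ^ 3 \<le> K * En" using m_le FQ by linarith
    then show ?thesis unfolding \<theta>3 using K m_pos by (simp add: divide_simps mult.commute)
  qed
  have "1 / K \<le> \<theta>"
  proof (cases "\<theta> \<le> 1")
    case True
    then have "\<theta> ^ 3 \<le> \<theta> ^ 1" using \<theta>_pos by (intro power_decreasing) auto
    then show ?thesis using \<theta>3_ge by simp
  next
    case False
    then show ?thesis using K by (simp add: divide_le_eq_1 order_trans[of _ 1])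
  qed
  then have \<theta>_depth: "\<theta> powr (- depth_exp h) \<le> K powr depth_exp h"
  proof -
    have "\<theta> powr (- depth_exp h) \<le> (1 / K) powr (- depth_exp h)"
      using \<open>1 / K \<le> \<theta>\<close> K depth_exp_nonneg[OF h] by (intro powr_mono2') auto
    also have "\<dots> = K powr depth_exp h" using K by (simp add: powr_divide powr_minus_divide)
    finally show ?thesis .
  qed
  define Ps where "Ps = (\<Union>a\<in>X. prime_factors a)"
  have "\<exists>H\<subseteq>X. \<theta> powr loss_exp * m \<le> (\<Sum>a\<in>H. r a ^ 4) \<and> Lambda_bound h H (\<theta> powr (- depth_exp h))"
    unfolding \<theta>_def m_def En_def
  proof (rule large_subset_with_Lambda_bound[OF _ h X r0])
    show "finite Ps" using X by (simp add: Ps_def)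
    show "prime p" if "p \<in> Ps" for p using that by (auto simp: Ps_def)
    show "multiplicity p a = multiplicity p b" if "prime p" "p \<notin> Ps" "a \<in> X" "b \<in> X" for p a b
    proof -
      have "multiplicity p c = 0" if "c \<in> X" for c
      proof (rule not_dvd_imp_multiplicity_0)
        show "\<not> p dvd c"
        proof
          assume "p dvd c"
          moreover have "c \<noteq> 0" using that X by auto
          ultimately have "p \<in> prime_factors c" using \<open>prime p\<close> by (simp add: prime_factors_dvd)
          then show False using \<open>p \<notin> Ps\<close> that by (auto simp: Ps_def)
        qed
      qed
      then show ?thesis using that by simp
    qed
  qed
  then obtain H where H: "H \<subseteq> X" "\<theta> powr loss_exp * m \<le> (\<Sum>a\<in>H. r a ^ 4)"
      "Lambda_bound h H (\<theta> powr (- depth_exp h))" by blast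
  have finH: "finite H" using H X finite_subset by blast
  have fH: "0 \<le> f a" if "a \<in> H" for a using f H that by (auto simp: less_imp_le)
  \<comment> \<open>The second moment of f on H is at most Q, so Q cancels; taking square roots
    afterwards leaves the exponent \<open>loss_exp\<close>.\<close>
  have "K powr (- 2 * loss_exp) * F\<^sup>2 * Q \<le> (sum f H)\<^sup>2 * Q"
  proof -
    have "K powr (- 2 * loss_exp) * F\<^sup>2 * Q \<le> K powr (- 2 * loss_exp) * (K * En)"
      unfolding mult.assoc by (intro mult_left_mono FQ) auto
    also have "\<dots> \<le> K powr (- 2 * loss_exp) * (K * m ^ 3)"
      using K by (intro mult_left_mono En_le) auto
    also have "\<dots> = K powr (1 - 2 * loss_exp) * m ^ 3"
      using K by (simp add: powr_diff powr_minus divide_simps)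
    also have "\<dots> \<le> K powr (- loss_exp) * m ^ 3"
      using K m_pos loss_exp_ge by (intro mult_right_mono powr_mono) auto
    also have "K powr (- loss_exp) = (1 / K) powr loss_exp"
      using K by (simp add: powr_divide powr_minus_divide)
    also have "(1 / K) powr loss_exp * m ^ 3 \<le> (\<theta> ^ 3) powr loss_exp * m ^ 3"
      using \<theta>3_ge K m_pos loss_exp_ge by (intro mult_right_mono powr_mono2) auto
    also have "\<dots> = (\<theta> powr loss_exp * m) ^ 3"
    proof -
      have "(\<theta> ^ 3) powr loss_exp = (\<theta> powr 3) powr loss_exp" using \<theta>_pos by simp
      also have "\<dots> = \<theta> powr (3 * loss_exp)" by (rule powr_powr)
      also have "\<dots> = (\<theta> powr loss_exp) ^ 3"
        using \<theta>_pos by (simp add: powr_power mult.commute)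
      finally show ?thesis by (simp only: power_mult_distrib)
    qed
    also have "\<dots> \<le> (\<Sum>a\<in>H. r a ^ 4) ^ 3" using H(2) m_pos by (intro power_mono) auto
    also have "\<dots> \<le> (sum f H)\<^sup>2 * (\<Sum>a\<in>H. (f a)\<^sup>2)"
    proof -
      have "0 \<le> r a" if "a \<in> H" for a using r0[OF subsetD[OF H(1) that]] by simp
      from sum_power_interpolation[of H r, OF this] show ?thesis unfolding r3 r6 .
    qed
    also have "\<dots> \<le> (sum f H)\<^sup>2 * Q"
      unfolding Q_def using H(1) X(1) by (intro mult_left_mono sum_mono2) auto
    finally show ?thesis .
  qed
  then have "K powr (- 2 * loss_exp) * F\<^sup>2 \<le> (sum f H)\<^sup>2" using Q_pos by simp
  moreover have "K powr (- 2 * loss_exp) = (K powr (- loss_exp))\<^sup>2"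
    using K by (simp add: powr_power)
  ultimately have "(K powr (- loss_exp) * F)\<^sup>2 \<le> (sum f H)\<^sup>2" by (simp add: power_mult_distrib)
  then have "K powr (- loss_exp) * F \<le> sum f H"
    by (rule power2_le_imp_le) (rule sum_nonneg[OF fH])
  moreover have "Lambda_bound h H (K powr depth_exp h)"
    by (rule Lambda_bound_mono[OF H(3) powr_ge_zero \<theta>_depth])
  ultimately show ?thesis using H(1) by (auto simp: F_def)
qed

section \<open>Sets with large multiplicative energy\<close>

abbreviation tuples :: "int set \<Rightarrow> nat \<Rightarrow> (nat \<Rightarrow> int) set" where
  "tuples A s \<equiv> {0..<s} \<rightarrow>\<^sub>E A"

text \<open>The absolute value keeps products positive, as logarithms require. Forgetting signs can
  only increase the energy, and the signs are recovered at the end by splitting a subset of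
  A.\<close>

definition abs_prod :: "nat \<Rightarrow> (nat \<Rightarrow> int) \<Rightarrow> int" where
  "abs_prod s x = \<bar>\<Prod>i\<in>{0..<s}. x i\<bar>"

definition join :: "nat \<Rightarrow> nat \<Rightarrow> (nat \<Rightarrow> int) \<Rightarrow> (nat \<Rightarrow> int) \<Rightarrow> nat \<Rightarrow> int" where
  "join s t y z = (\<lambda>i\<in>{0..<s+t}. if i < s then y i else z (i - s))"

lemma sum_tuples_add:
  "(\<Sum>x\<in>tuples A (s + t). G x) = (\<Sum>y\<in>tuples A s. \<Sum>z\<in>tuples A t. G (join s t y z))"
proof -
  have "(\<Sum>x\<in>tuples A (s + t). G x) = (\<Sum>p\<in>tuples A s \<times> tuples A t. G (join s t (fst p) (snd p)))"
  proof (rule sum.reindex_bij_witness)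
    let ?split = "\<lambda>x. (restrict x {0..<s}, \<lambda>i\<in>{0..<t}. x (s + i))"
    show "?split x \<in> tuples A s \<times> tuples A t" if "x \<in> tuples A (s + t)" for x
      using that by (auto simp: PiE_iff)
    show "join s t (fst p) (snd p) \<in> tuples A (s + t)" if "p \<in> tuples A s \<times> tuples A t" for p
      using that by (auto simp: join_def PiE_iff)
    show j: "join s t (fst (?split x)) (snd (?split x)) = x" if "x \<in> tuples A (s + t)" for x
      using that by (auto simp: join_def PiE_iff fun_eq_iff extensional_def)
    show "?split (join s t (fst p) (snd p)) = p" if "p \<in> tuples A s \<times> tuples A t" for p
      using that by (auto simp: join_def PiE_iff fun_eq_iff extensional_def prod_eq_iff)
    show "G (join s t (fst (?split x)) (snd (?split x))) = G x" if "x \<in> tuples A (s + t)" for x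
      by (simp only: j[OF that])
  qed
  then show ?thesis by (simp add: sum.cartesian_product')
qed

lemma prod_join:
  "(\<Prod>i\<in>{0..<s}. join s t y z i) = (\<Prod>i\<in>{0..<s}. y i)"
  "(\<Prod>i\<in>{s..<s+t}. join s t y z i) = (\<Prod>i\<in>{0..<t}. z i)"
proof -
  show "(\<Prod>i\<in>{0..<s}. join s t y z i) = (\<Prod>i\<in>{0..<s}. y i)"
    by (intro prod.cong) (auto simp: join_def)
  have "(\<Prod>i\<in>{s..<s+t}. join s t y z i) = (\<Prod>i\<in>{0..<t}. join s t y z (i + s))"
    using prod.shift_bounds_nat_ivl[of "join s t y z" 0 s t] by (simp add: add.commute)
  also have "\<dots> = (\<Prod>i\<in>{0..<t}. z i)"
    by (intro prod.cong) (auto simp: join_def)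
  finally show "(\<Prod>i\<in>{s..<s+t}. join s t y z i) = (\<Prod>i\<in>{0..<t}. z i)" .
qed

lemma abs_prod_join: "abs_prod (s + t) (join s t y z) = abs_prod s y * abs_prod t z"
proof -
  have "(\<Prod>i\<in>{0..<s+t}. join s t y z i) = (\<Prod>i\<in>{0..<s}. join s t y z i) * (\<Prod>i\<in>{s..<s+t}. join s t y z i)"
    by (rule prod.atLeastLessThan_concat[symmetric]) auto
  then show ?thesis by (simp add: abs_prod_def prod_join abs_mult)
qed

definition prod_count :: "int set \<Rightarrow> nat \<Rightarrow> int \<Rightarrow> real" where
  "prod_count A s n = real (card {x \<in> tuples A s. abs_prod s x = n})"

definition abs_energy :: "int set \<Rightarrow> nat \<Rightarrow> real" where
  "abs_energy A s = (\<Sum>y\<in>tuples A s. \<Sum>z\<in>tuples A s. if abs_prod s y = abs_prod s z then 1 else 0)"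

lemma finite_tuples: "finite A \<Longrightarrow> finite (tuples A s)"
  by (simp add: finite_PiE)

lemma sum_tuples_abs_prod:
  assumes "finite A"
  shows "(\<Sum>y\<in>tuples A s. g (abs_prod s y)) = (\<Sum>n\<in>abs_prod s ` tuples A s. prod_count A s n * g n)"
proof -
  have "(\<Sum>y\<in>tuples A s. g (abs_prod s y))
      = (\<Sum>n\<in>abs_prod s ` tuples A s. \<Sum>y\<in>{y\<in>tuples A s. abs_prod s y = n}. g (abs_prod s y))"
    by (rule sum.image_gen[OF finite_tuples[OF assms]])
  also have "\<dots> = (\<Sum>n\<in>abs_prod s ` tuples A s. prod_count A s n * g n)"
    by (intro sum.cong refl) (simp add: prod_count_def)
  finally show ?thesis .
qed

lemma mult_energy_le_abs_energy:
  assumes "finite A"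
  shows "real (mult_energy s A) \<le> abs_energy A s"
proof -
  let ?E = "\<lambda>x. (\<Prod>i<s. x i) = (\<Prod>i\<in>{s..<2*s}. x i)"
  have "real (mult_energy s A) = (\<Sum>x\<in>{x\<in>tuples A (s + s). ?E x}. 1)"
    by (simp add: mult_energy_def mult_2)
  also have "\<dots> = (\<Sum>x\<in>tuples A (s + s). if ?E x then 1 else 0)"
    by (rule sum.inter_filter[OF finite_tuples[OF assms]])
  also have "\<dots> = (\<Sum>y\<in>tuples A s. \<Sum>z\<in>tuples A s. if (\<Prod>i\<in>{0..<s}. y i) = (\<Prod>i\<in>{0..<s}. z i) then 1 else 0)"
    unfolding sum_tuples_add mult_2 lessThan_atLeast0 prod_join ..
  also have "\<dots> \<le> abs_energy A s"
    unfolding abs_energy_def by (intro sum_mono) (auto simp: abs_prod_def)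
  finally show ?thesis .
qed

lemma abs_energy_eq_sum_squares:
  assumes "finite A"
  shows "abs_energy A s = (\<Sum>n\<in>abs_prod s ` tuples A s. (prod_count A s n)\<^sup>2)"
proof -
  have "abs_energy A s = ker_sum (abs_prod s) (\<lambda>_. 1) (tuples A s) (abs_prod s) (\<lambda>_. 1) (tuples A s)"
    by (simp add: abs_energy_def ker_sum_def cong: if_cong)
  also have "\<dots> = (\<Sum>n\<in>abs_prod s ` tuples A s. (prod_count A s n)\<^sup>2)"
    using finite_tuples[OF assms] by (subst ker_sum_eq[where Z = "abs_prod s ` tuples A s"]) (auto simp: prod_count_def power2_eq_square)
  finally show ?thesis .
qed

lemma abs_prod_pos:
  assumes "0 \<notin> A" "x \<in> tuples A s"
  shows "0 < abs_prod s x"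
  using assms by (auto simp: abs_prod_def PiE_iff)

text \<open>Splitting each side of the relation in half, the 2s-fold energy is the energy of the
  s-fold representation function. This is why scales are doubled and s is a power of two.\<close>

lemma abs_energy_double:
  assumes fin: "finite A" and A: "0 \<notin> A"
  shows "abs_energy A (s + s) = energy (\<lambda>a. ln (real_of_int a)) (prod_count A s) (abs_prod s ` tuples A s)"
proof -
  let ?X = "tuples A s" and ?S = "abs_prod s ` tuples A s" and ?p = "abs_prod s" and ?c = "prod_count A s"
  let ?i = "\<lambda>a b c d. if a * b = c * d then 1 else (0::real)"
  have "abs_energy A (s + s) = (\<Sum>y\<in>?X. \<Sum>z\<in>?X. \<Sum>y'\<in>?X. \<Sum>z'\<in>?X. ?i (?p y) (?p z) (?p y') (?p z'))"
    by (simp only: abs_energy_def sum_tuples_add abs_prod_join)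
  also have "\<dots> = (\<Sum>a\<in>?S. ?c a * (\<Sum>b\<in>?S. ?c b * (\<Sum>c\<in>?S. ?c c * (\<Sum>d\<in>?S. ?c d * ?i a b c d))))"
  proof -
    have 1: "(\<Sum>z'\<in>?X. ?i a b c (?p z')) = (\<Sum>d\<in>?S. ?c d * ?i a b c d)" for a b c
      by (rule sum_tuples_abs_prod[OF fin])
    have 2: "(\<Sum>y'\<in>?X. \<Sum>d\<in>?S. ?c d * ?i a b (?p y') d) = (\<Sum>c\<in>?S. ?c c * (\<Sum>d\<in>?S. ?c d * ?i a b c d))" for a b
      by (rule sum_tuples_abs_prod[OF fin])
    have 3: "(\<Sum>z\<in>?X. \<Sum>c\<in>?S. ?c c * (\<Sum>d\<in>?S. ?c d * ?i a (?p z) c d))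
        = (\<Sum>b\<in>?S. ?c b * (\<Sum>c\<in>?S. ?c c * (\<Sum>d\<in>?S. ?c d * ?i a b c d)))" for a
      by (rule sum_tuples_abs_prod[OF fin])
    have 4: "(\<Sum>y\<in>?X. \<Sum>b\<in>?S. ?c b * (\<Sum>c\<in>?S. ?c c * (\<Sum>d\<in>?S. ?c d * ?i (?p y) b c d)))
        = (\<Sum>a\<in>?S. ?c a * (\<Sum>b\<in>?S. ?c b * (\<Sum>c\<in>?S. ?c c * (\<Sum>d\<in>?S. ?c d * ?i a b c d))))"
      by (rule sum_tuples_abs_prod[OF fin])
    show ?thesis unfolding 1 2 3 4 ..
  qed
  also have "\<dots> = energy (\<lambda>a. ln (real_of_int a)) ?c ?S"
    unfolding quad_def sum_distrib_left
  proof (intro sum.cong refl)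
    fix a b c d assume "a \<in> ?S" "b \<in> ?S" "c \<in> ?S" "d \<in> ?S"
    then have pos: "0 < a" "0 < b" "0 < c" "0 < d" using abs_prod_pos[OF A] by auto
    show "?c a * (?c b * (?c c * (?c d * ?i a b c d)))
        = (if ln (real_of_int a) + ln (real_of_int b) = ln (real_of_int c) + ln (real_of_int d) then ?c a * ?c b * ?c c * ?c d else 0)"
      unfolding ln_int_sum_eq_iff[OF pos] by simp
  qed
  finally show ?thesis .
qed

lemma ex_ratio_ge_geometric_mean:
  fixes \<rho> :: "nat \<Rightarrow> real"
  assumes "\<rho> 0 \<le> 1" "0 \<le> \<delta>" "\<delta> ^ L < \<rho> L"
  shows "\<exists>i<L. \<delta> * \<rho> i \<le> \<rho> (Suc i)"
proof (rule ccontr)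
  assume "\<not> ?thesis"
  then have less: "\<rho> (Suc i) \<le> \<delta> * \<rho> i" if "i < L" for i using that by force
  have "\<rho> i \<le> \<delta> ^ i" if "i \<le> L" for i
    using that
  proof (induction i)
    case (Suc i)
    then have "\<rho> (Suc i) \<le> \<delta> * \<rho> i" using less by simp
    also have "\<dots> \<le> \<delta> * \<delta> ^ i" using Suc assms(2) by (intro mult_left_mono) auto
    finally show ?case by simp
  qed (use assms(1) in simp)
  then show False using assms(3) by force
qed

text \<open>The normalised energies at scales 1, 2, 4, ..., 2^L start at most at 1 and end above
  |A|^(-k), so some doubling loses at most the factor K. At that scale the representation function
  is energetic up to K.\<close>

lemma structured_subset:
  assumes h: "0 < h" and fin: "finite A" and A: "A \<noteq> {}" "0 \<notin> A" and L: "0 < L" and k: "0 \<le> k"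
    and big: "real (card A) powr (2 * 2 ^ L - k) < real (mult_energy (2 ^ L) A)"
  defines "K \<equiv> real (card A) powr (k / L)"
  shows "\<exists>T\<subseteq>A. K powr (- loss_exp) * card A / 2 \<le> card T \<and>
    add_energy h T \<le> (K powr depth_exp h * card T) ^ h"
proof -
  define N where "N = real (card A)"
  have N1: "1 \<le> N" using fin A(1) by (simp add: N_def Suc_le_eq card_gt_0_iff)
  have K1: "1 \<le> K" using N1 k L unfolding K_def N_def[symmetric] by (intro ge_one_powr_ge_zero) auto
  define \<rho> where "\<rho> = (\<lambda>i. abs_energy A (2 ^ i) / N ^ (2 * 2 ^ i))"
  have card_tuples: "real (card (tuples A s)) = N ^ s" for s
    using fin by (simp add: card_PiE N_def)
  have "\<exists>i<L. (1 / K) * \<rho> i \<le> \<rho> (Suc i)"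
  proof (rule ex_ratio_ge_geometric_mean)
    have "abs_energy A 1 \<le> (\<Sum>y\<in>tuples A 1. \<Sum>z\<in>tuples A 1. 1)"
      unfolding abs_energy_def by (intro sum_mono) auto
    also have "\<dots> = N ^ 2" using card_tuples[of 1] by (simp add: power2_eq_square)
    finally show "\<rho> 0 \<le> 1" using N1 by (simp add: \<rho>_def)
    show "0 \<le> 1 / K" using K1 by simp
    have "(1 / K) ^ L = 1 / N powr k"
      using N1 L by (simp add: K_def N_def[symmetric] power_divide powr_power)
    also have "\<dots> = N powr (2 * 2 ^ L - k) / N ^ (2 * 2 ^ L)"
      using N1 by (simp add: powr_diff flip: powr_realpow)
    also have "\<dots> < real (mult_energy (2 ^ L) A) / N ^ (2 * 2 ^ L)"
      using big N1 by (intro divide_strict_right_mono) (auto simp: N_def)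
    also have "\<dots> \<le> \<rho> L"
      unfolding \<rho>_def using N1 by (intro divide_right_mono mult_energy_le_abs_energy fin) auto
    finally show "(1 / K) ^ L < \<rho> L" .
  qed
  then obtain i where i: "(1 / K) * \<rho> i \<le> \<rho> (Suc i)" by blast
  define s :: nat where "s = 2 ^ i"
  define S where "S = abs_prod s ` tuples A s"
  let ?c = "prod_count A s"
  have s: "0 < s" by (simp add: s_def)
  have finS: "finite S" using fin by (simp add: S_def finite_tuples)
  have S_pos: "S \<subseteq> {0<..}" using abs_prod_pos[OF A(2)] by (auto simp: S_def)
  have sum_c: "sum ?c S = N ^ s"
    using sum_tuples_abs_prod[OF fin, of "\<lambda>_. 1" s] card_tuples[of s] by (simp add: S_def)
  have "tuples A s \<noteq> {}" using A(1) by (simp add: PiE_eq_empty_iff)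
  then have S_ne: "S \<noteq> {}" by (simp add: S_def)
  have c_pos: "0 < ?c n" if "n \<in> S" for n
    using that fin finite_tuples[OF fin, of s] by (auto simp: S_def prod_count_def card_gt_0_iff)
  have "\<exists>H\<subseteq>S. K powr (- loss_exp) * sum ?c S \<le> sum ?c H \<and> Lambda_bound h H (K powr depth_exp h)"
  proof (rule large_subset_of_energetic_function[OF h finS S_ne S_pos c_pos K1])
    define P where "P = N ^ (2 * s)"
    have P: "0 < P" using N1 by (simp add: P_def)
    have 1: "(2::nat) ^ Suc i = s + s" "2 * (s + s) = 2 * s + 2 * s" by (simp_all only: power_Suc s_def mult_2)
    have "\<rho> (Suc i) = abs_energy A (s + s) / (P * P)" unfolding \<rho>_def 1 power_add P_def by (rule refl)
    moreover have "\<rho> i = abs_energy A s / P" by (simp only: \<rho>_def s_def P_def)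
    ultimately have le: "(1 / K) * (abs_energy A s / P) \<le> abs_energy A (s + s) / (P * P)"
      using i by (simp only:)
    have clear: "P * x \<le> K * y" if "(1 / K) * (x / P) \<le> y / (P * P)" for x y
    proof -
      have "K * (P * P) * ((1 / K) * (x / P)) \<le> K * (P * P) * (y / (P * P))"
        using that K1 P by (intro mult_left_mono) auto
      then show ?thesis using K1 P by simp
    qed
    have "P * abs_energy A s \<le> K * abs_energy A (s + s)" by (rule clear[OF le])
    moreover have "abs_energy A (s + s) = energy (\<lambda>a. ln (real_of_int a)) ?c S"
      unfolding S_def by (rule abs_energy_double[OF fin A(2)])
    moreover have "abs_energy A s = (\<Sum>a\<in>S. (?c a)\<^sup>2)"
      unfolding S_def by (rule abs_energy_eq_sum_squares[OF fin])
    moreover have "P = (sum ?c S)\<^sup>2" unfolding sum_c P_def by (simp add: mult.commute flip: power_mult)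
    ultimately show "(sum ?c S)\<^sup>2 * (\<Sum>a\<in>S. (?c a)\<^sup>2) \<le> K * energy (\<lambda>a. ln (real_of_int a)) ?c S"
      by (simp only:)
  qed
  then obtain H where H: "H \<subseteq> S" "K powr (- loss_exp) * N ^ s \<le> sum ?c H" "Lambda_bound h H (K powr depth_exp h)"
    unfolding sum_c by blast
  have finH: "finite H" using H(1) finS finite_subset by blast
  \<comment> \<open>H captures a large share of the s-tuples. Averaging over the first s - 1
    coordinates, some product t of these leaves at least the same share of last coordinates a with t
    |a| in H.\<close>
  have "\<exists>t>0. K powr (- loss_exp) * N \<le> real (card {a\<in>A. t * \<bar>a\<bar> \<in> H})"
  proof (rule ccontr)
    assume neg: "\<not> ?thesis"
    obtain s' where s': "s = s' + 1" using s by (metis Suc_eq_plus1 gr0_implies_Suc)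
    have ne: "tuples A s' \<noteq> {}" using A(1) by (simp add: PiE_eq_empty_iff)
    have sum1: "(\<Sum>z\<in>tuples A 1. g (abs_prod 1 z)) = (\<Sum>a\<in>A. g \<bar>a\<bar>)" for g :: "int \<Rightarrow> real"
      by (rule sum.reindex_bij_witness[where i = "\<lambda>a. \<lambda>i\<in>{0..<1}. a" and j = "\<lambda>z. z 0"])
        (auto simp: PiE_iff abs_prod_def fun_eq_iff extensional_def)
    have "sum ?c H = (\<Sum>n\<in>S. ?c n * (if n \<in> H then 1 else 0))"
      using H(1) finS by (simp add: sum.inter_restrict[symmetric] Int_absorb1 if_distrib cong: if_cong)
    also have "\<dots> = (\<Sum>x\<in>tuples A (s' + 1). if abs_prod (s' + 1) x \<in> H then 1 else 0)"
      unfolding S_def s' by (rule sum_tuples_abs_prod[OF fin, symmetric])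
    also have "\<dots> = (\<Sum>y\<in>tuples A s'. \<Sum>z\<in>tuples A 1. if abs_prod s' y * abs_prod 1 z \<in> H then 1 else 0)"
      unfolding sum_tuples_add abs_prod_join ..
    also have "\<dots> = (\<Sum>y\<in>tuples A s'. \<Sum>a\<in>A. if abs_prod s' y * \<bar>a\<bar> \<in> H then 1 else 0)"
      by (intro sum.cong refl sum1)
    also have "\<dots> = (\<Sum>y\<in>tuples A s'. real (card {a\<in>A. abs_prod s' y * \<bar>a\<bar> \<in> H}))"
      using fin by (simp flip: sum.inter_filter)
    also have "\<dots> < (\<Sum>y\<in>tuples A s'. K powr (- loss_exp) * N)"
      using neg abs_prod_pos[OF A(2)] by (intro sum_strict_mono finite_tuples fin ne) (auto simp: not_le)
    also have "\<dots> = K powr (- loss_exp) * N ^ s" by (simp add: card_tuples s')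
    finally show False using H(2) by simp
  qed
  then obtain t where t: "0 < t" "K powr (- loss_exp) * N \<le> real (card {a\<in>A. t * \<bar>a\<bar> \<in> H})" by blast
  \<comment> \<open>On each sign class the condition says that t a, respectively - t a, lies in H,
    so the \<Lambda> bound transfers by dilation; taking the larger class costs the factor
    2.\<close>
  define P M where "P = {a\<in>A. 0 < a \<and> t * \<bar>a\<bar> \<in> H}" and "M = {a\<in>A. a < 0 \<and> t * \<bar>a\<bar> \<in> H}"
  have "{a\<in>A. t * \<bar>a\<bar> \<in> H} = P \<union> M" using A(2) by (auto simp: P_def M_def not_less_iff_gr_or_eq)
  moreover have "card (P \<union> M) = card P + card M"
    using fin by (intro card_Un_disjoint) (auto simp: P_def M_def)
  ultimately have PM: "K powr (- loss_exp) * N \<le> real (card P) + real (card M)" using t(2) by simp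
  have LP: "Lambda_bound h P (K powr depth_exp h)"
    by (rule Lambda_bound_dilate[OF H(3) finH, of t]) (use t in \<open>auto simp: P_def\<close>)
  have LM: "Lambda_bound h M (K powr depth_exp h)"
    by (rule Lambda_bound_dilate[OF H(3) finH, of "- t"]) (use t in \<open>auto simp: M_def\<close>)
  have energy: "real (add_energy h T) \<le> (K powr depth_exp h * real (card T)) ^ h"
    if "Lambda_bound h T (K powr depth_exp h)" "T \<subseteq> A" for T
  proof -
    have "finite T" using that(2) fin finite_subset by blast
    then show ?thesis using Lambda_boundD[OF that(1), of "\<lambda>_. 1"] by (simp add: add_energy_eq)
  qed
  show ?thesis
  proof (cases "card M \<le> card P")
    case True
    then have "K powr (- loss_exp) * N / 2 \<le> real (card P)" using PM by linarith
    moreover have "P \<subseteq> A" by (auto simp: P_def)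
    ultimately show ?thesis using energy[OF LP] unfolding N_def by blast
  next
    case False
    then have "K powr (- loss_exp) * N / 2 \<le> real (card M)" using PM by linarith
    moreover have "M \<subseteq> A" by (auto simp: M_def)
    ultimately show ?thesis using energy[OF LM] unfolding N_def by blast
  qed
qed

section \<open>The decomposition\<close>

text \<open>The tangent of the concave function x^(3/4); with t = (y/x)^(1/4) it is AM-GM for 1 and
  three copies of t^4. It lets the costs of the removed pieces telescope.\<close>

lemma powr_three_quarters_diff:
  fixes x y :: real
  assumes "0 < x" "0 \<le> y" "y \<le> x"
  shows "3 / 4 * (x - y) * x powr (- 1 / 4) \<le> x powr (3 / 4) - y powr (3 / 4)"
proof -
  define t where "t = (y / x) powr (1 / 4)"
  have t0: "0 \<le> t" by (simp add: t_def)
  have pow: "t ^ n = (y / x) powr (real n / 4)" if "0 < n" for n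
  proof (cases "y / x = 0")
    case True
    then show ?thesis unfolding t_def True using that by simp
  next
    case False
    show ?thesis unfolding t_def powr_power[OF False] by simp
  qed
  have "t ^ 4 = (y / x) powr (real 4 / 4)" by (rule pow) simp
  also have "\<dots> = y / x" using assms by simp
  finally have t4: "t ^ 4 = y / x" .
  have "t ^ 3 = (y / x) powr (real 3 / 4)" by (rule pow) simp
  then have t3: "t ^ 3 = y powr (3 / 4) / x powr (3 / 4)" unfolding powr_divide of_nat_numeral .
  have x34: "x powr (3 / 4) = x * x powr (- 1 / 4)"
    using assms powr_add[of x 1 "- 1 / 4"] by simp
  have "4 * t ^ 3 \<le> 1 + 3 * t ^ 4"
    using weighted_AM_GM_power[of 1 t 3] t0 by simp
  then have "3 / 4 * (1 - t ^ 4) \<le> 1 - t ^ 3" by simp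
  then have "x powr (3 / 4) * (3 / 4 * (1 - t ^ 4)) \<le> x powr (3 / 4) * (1 - t ^ 3)"
    by (intro mult_left_mono) auto
  also have "\<dots> = x powr (3 / 4) - y powr (3 / 4)"
    unfolding t3 using assms by (simp add: right_diff_distrib)
  also have "x powr (3 / 4) * (3 / 4 * (1 - t ^ 4)) = 3 / 4 * (x * (1 - y / x)) * x powr (- 1 / 4)"
    unfolding t4 x34 by simp
  also have "x * (1 - y / x) = x - y" using assms by (simp add: right_diff_distrib)
  finally show ?thesis .
qed

lemma add_energy_empty: "0 < h \<Longrightarrow> add_energy h {} = 0"
  and mult_energy_empty: "0 < h \<Longrightarrow> mult_energy h {} = 0"
proof -
  assume "0 < h"
  then have "{0..<2*h} \<rightarrow>\<^sub>E ({} :: int set) = {}"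
    by (auto simp: PiE_eq_empty_iff intro!: exI[of _ 0])
  then show "add_energy h {} = 0" "mult_energy h {} = 0"
    by (simp_all add: add_energy_def mult_energy_def)
qed

text \<open>Greedy removal, stopping as soon as the multiplicative bound holds. The potential 2
  |A|^(3/4) drops by at least the norm of each removed piece. The last clause records the size of
  the first piece, from which the bound in |A| becomes one in |B|.\<close>

lemma add_energy_decomposition:
  assumes h: "0 < h" and L: "0 < L" and k: "0 \<le> k"
    and small: "k / L * loss_exp \<le> 1 / 20" "k / L * depth_exp h \<le> 1 / 20"
    and fin: "finite A" and A: "0 \<notin> A"
  shows "\<exists>B C. B \<inter> C = {} \<and> A = B \<union> C \<and>
    real (mult_energy (2 ^ L) C) \<le> real (card C) powr (2 * 2 ^ L - k) \<and>
    root (2 * h) (add_energy h B) \<le> 2 * real (card A) powr (3 / 4) \<and>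
    (B = {} \<or> real (card A) powr (19 / 20) / 2 \<le> real (card B))"
  using fin A
proof (induction "card A" arbitrary: A rule: less_induct)
  case less
  define N where "N = real (card A)"
  have empty: "add_energy h {} = 0" by (rule add_energy_empty[OF h])
  show ?case
  proof (cases "real (mult_energy (2 ^ L) A) \<le> N powr (2 * 2 ^ L - k)")
    case True
    then show ?thesis using empty h by (intro exI[of _ "{}"] exI[of _ A]) (simp add: N_def)
  next
    case False
    then have big: "real (card A) powr (2 * 2 ^ L - k) < real (mult_energy (2 ^ L) A)" by (simp add: N_def)
    have "A \<noteq> {}"
    proof
      assume "A = {}"
      then have "mult_energy (2 ^ L) A = 0" by (simp add: mult_energy_empty)
      then show False using big by simp
    qed
    then have N1: "1 \<le> N" using less.prems(1) by (simp add: N_def Suc_le_eq card_gt_0_iff)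
    obtain T where T: "T \<subseteq> A" "(N powr (k / L)) powr (- loss_exp) * N / 2 \<le> card T"
        "add_energy h T \<le> ((N powr (k / L)) powr depth_exp h * card T) ^ h"
      using structured_subset[OF h less.prems(1) \<open>A \<noteq> {}\<close> less.prems(2) L k big] by (auto simp: N_def)
    define n where "n = real (card T)"
    have n_le: "n \<le> N" unfolding n_def N_def using T(1) less.prems(1) by (simp add: card_mono)
    have n_ge: "N powr (19 / 20) / 2 \<le> n"
    proof -
      have "N powr (19 / 20) = N powr (- 1 / 20) * N" using N1 powr_add[of N "- 1 / 20" 1] by simp
      also have "\<dots> \<le> N powr (- (k / L * loss_exp)) * N"
        using small(1) N1 by (intro mult_right_mono powr_mono) auto
      also have "N powr (- (k / L * loss_exp)) = (N powr (k / L)) powr (- loss_exp)"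
        by (simp add: powr_powr)
      finally show ?thesis using T(2) by (simp add: n_def)
    qed
    have n_pos: "0 < n" using n_ge N1 powr_gt_zero[of N "19 / 20"] by linarith
    have finT: "finite T" using T(1) less.prems(1) finite_subset by blast
    have "T \<noteq> {}" using n_pos by (auto simp: n_def)
    then have "card (A - T) < card A" using T(1) less.prems(1) by (intro psubset_card_mono) auto
    moreover have "finite (A - T)" "0 \<notin> A - T" using less.prems by auto
    ultimately obtain B C where BC: "B \<inter> C = {}" "A - T = B \<union> C"
        "real (mult_energy (2 ^ L) C) \<le> real (card C) powr (2 * 2 ^ L - k)"
        "root (2 * h) (add_energy h B) \<le> 2 * real (card (A - T)) powr (3 / 4)"
      using less.hyps[of "A - T"] by blast
    have finB: "finite B" using BC(2) less.prems(1) finite_subset[of B A] by auto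
    have rootT: "root (2 * h) (add_energy h T) \<le> sqrt (N powr (1 / 20) * n)"
    proof -
      have "(N powr (k / L)) powr depth_exp h \<le> N powr (1 / 20)"
        unfolding powr_powr using small(2) N1 by (intro powr_mono) auto
      then have "((N powr (k / L)) powr depth_exp h * card T) ^ h \<le> (N powr (1 / 20) * n) ^ h"
        unfolding n_def by (intro power_mono mult_right_mono) auto
      then have "add_energy h T \<le> (N powr (1 / 20) * n) ^ h" using T(3) by linarith
      also have "\<dots> = sqrt (N powr (1 / 20) * n) ^ (2 * h)"
        using n_pos by (simp add: power_mult)
      finally have "root (2 * h) (add_energy h T) \<le> root (2 * h) (sqrt (N powr (1 / 20) * n) ^ (2 * h))"
        using h by (intro real_root_le_mono) auto
      also have "\<dots> = sqrt (N powr (1 / 20) * n)" using h n_pos by (intro real_root_power_cancel) auto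
      finally show ?thesis .
    qed
    \<comment> \<open>After squaring, this asks for N^(11/20) \<le> 9/4 n, and n is at least
      N^(19/20)/2. The right side is twice the tangent estimate for the drop of N^(3/4).\<close>
    have sqrt_le: "sqrt (N powr (1 / 20) * n) \<le> 2 * (3 / 4 * n * N powr (- 1 / 4))"
    proof (rule real_le_lsqrt)
      have "N powr (1 / 20) * N powr (1 / 2) \<le> N powr (19 / 20)"
        using N1 by (simp add: powr_mono flip: powr_add)
      also have "\<dots> \<le> 9 / 4 * n" using n_ge n_pos by linarith
      finally have "N powr (1 / 20) * N powr (1 / 2) * (n * N powr (- 1 / 2)) \<le> 9 / 4 * n * (n * N powr (- 1 / 2))"
        using n_pos by (intro mult_right_mono) auto
      moreover have "N powr (1 / 20) * N powr (1 / 2) * (n * N powr (- 1 / 2)) = N powr (1 / 20) * n"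
      proof -
        have 1: "N powr (1 / 2) * N powr (- 1 / 2) = 1" using N1 by (simp flip: powr_add)
        have "N powr (1 / 20) * N powr (1 / 2) * (n * N powr (- 1 / 2))
            = N powr (1 / 20) * n * (N powr (1 / 2) * N powr (- 1 / 2))"
          by (simp only: mult_ac)
        then show ?thesis unfolding 1 by simp
      qed
      moreover have "(2 * (3 / 4 * n * N powr (- 1 / 4)))\<^sup>2 = 9 / 4 * n * (n * N powr (- 1 / 2))"
      proof -
        have "(N powr (- 1 / 4))\<^sup>2 = N powr (- 1 / 2)" using N1 by (simp add: powr_power)
        then show ?thesis by (simp add: power_mult_distrib power_divide) (simp add: power2_eq_square)
      qed
      ultimately show "N powr (1 / 20) * n \<le> (2 * (3 / 4 * n * N powr (- 1 / 4)))\<^sup>2" by (simp only:)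
    qed (use n_pos in auto)
    have card_diff: "real (card (A - T)) = N - n"
      using T(1) finT less.prems(1) by (simp add: card_Diff_subset of_nat_diff card_mono N_def n_def)
    have "root (2 * h) (add_energy h (T \<union> B)) \<le> root (2 * h) (add_energy h T) + root (2 * h) (add_energy h B)"
      using BC(2) by (intro root_add_energy_Un_le h finT finB) auto
    also have "\<dots> \<le> 2 * (3 / 4 * n * N powr (- 1 / 4)) + 2 * (N - n) powr (3 / 4)"
      using rootT sqrt_le BC(4) unfolding card_diff by linarith
    also have "\<dots> \<le> 2 * N powr (3 / 4)"
      using powr_three_quarters_diff[of N "N - n"] N1 n_le n_pos by simp
    finally have "root (2 * h) (add_energy h (T \<union> B)) \<le> 2 * real (card A) powr (3 / 4)" by (simp add: N_def)
    moreover have "n \<le> real (card (T \<union> B))"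
      unfolding n_def using finT finB by (simp add: card_mono)
    then have "real (card A) powr (19 / 20) / 2 \<le> real (card (T \<union> B))" using n_ge by (simp add: N_def)
    moreover have "(T \<union> B) \<inter> C = {}" "A = (T \<union> B) \<union> C" using BC(1,2) T(1) by auto
    ultimately show ?thesis using BC(3) by blast
  qed
qed

lemma add_energy_decomposition_with_zero:
  assumes h: "0 < h" and L: "0 < L" and k: "0 \<le> k"
    and small: "k / L * loss_exp \<le> 1 / 20" "k / L * depth_exp h \<le> 1 / 20"
    and fin: "finite A"
  shows "\<exists>B C. B \<inter> C = {} \<and> A = B \<union> C \<and>
    real (add_energy h B) \<le> 5 ^ (2 * h) * real (card B) powr (4 / 5 * (2 * real h)) \<and>
    real (mult_energy (2 ^ L) C) \<le> real (card C) powr (2 * 2 ^ L - k)"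
proof -
  have "finite (A - {0})" "0 \<notin> A - {0}" using fin by auto
  then obtain B C where BC: "B \<inter> C = {}" "A - {0} = B \<union> C"
      "real (mult_energy (2 ^ L) C) \<le> real (card C) powr (2 * 2 ^ L - k)"
      "root (2 * h) (add_energy h B) \<le> 2 * real (card (A - {0})) powr (3 / 4)"
      "B = {} \<or> real (card (A - {0})) powr (19 / 20) / 2 \<le> real (card B)"
    using add_energy_decomposition[OF h L k small, of "A - {0}"] by blast
  have finB: "finite B" using BC(2) fin finite_subset[of B A] by auto
  have empty: "add_energy h {} = 0" by (rule add_energy_empty[OF h])
  define N where "N = real (card (A - {0}))"
  have rootB: "root (2 * h) (add_energy h B) \<le> 4 * real (card B) powr (4 / 5)"
  proof (cases "B = {}")
    case True
    then show ?thesis using empty h by simp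
  next
    case False
    then have b1: "1 \<le> real (card B)" using finB by (simp add: Suc_le_eq card_gt_0_iff)
    have "N powr (19 / 20) \<le> 2 * real (card B)" using BC(5) False by (simp add: N_def)
    \<comment> \<open>19/20 times 15/19 is 3/4, and 15/19 is just below 4/5, the exponent wanted for
      |B|.\<close>
    then have "(N powr (19 / 20)) powr (15 / 19) \<le> (2 * real (card B)) powr (15 / 19)"
      by (intro powr_mono2) auto
    then have "N powr (3 / 4) \<le> (2 * real (card B)) powr (15 / 19)" by (simp add: powr_powr)
    also have "\<dots> = 2 powr (15 / 19) * real (card B) powr (15 / 19)" by (rule powr_mult)
    also have "\<dots> \<le> 2 powr 1 * real (card B) powr (4 / 5)"
      using b1 by (intro mult_mono powr_mono) auto
    finally show ?thesis using BC(4) by (simp add: N_def)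
  qed
  \<comment> \<open>0 has neither valuation nor logarithm, so it goes into the additive part. By
    Minkowski it adds at most 1 to the norm, whence 5 = 4 + 1.\<close>
  define B' where "B' = (if 0 \<in> A then insert 0 B else B)"
  have finB': "finite B'" using finB by (simp add: B'_def)
  have "root (2 * h) (add_energy h B') \<le> 5 * real (card B') powr (4 / 5)"
  proof (cases "0 \<in> A")
    case True
    have "0 \<notin> B" using BC(2) by auto
    have "real (add_energy h {0}) \<le> 1"
      using Lambda_boundD[OF Lambda_bound_singleton[of h 0], of "\<lambda>_. 1"] by (simp add: add_energy_eq)
    then have "root (2 * h) (add_energy h {0}) \<le> 1" using h by simp
    moreover have "root (2 * h) (add_energy h ({0} \<union> B)) \<le> root (2 * h) (add_energy h {0}) + root (2 * h) (add_energy h B)"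
      using \<open>0 \<notin> B\<close> finB by (intro root_add_energy_Un_le h) auto
    moreover have "real (card B) powr (4 / 5) \<le> real (card B') powr (4 / 5)"
      using True finB by (intro powr_mono2) (auto simp: B'_def card_insert_if)
    moreover have "1 \<le> real (card B') powr (4 / 5)"
      using True finB' by (intro ge_one_powr_ge_zero) (auto simp: B'_def Suc_le_eq card_gt_0_iff)
    moreover have "B' = {0} \<union> B" using True by (simp add: B'_def)
    ultimately show ?thesis using rootB by (simp only:)
  next
    case False
    then have B': "B' = B" by (simp add: B'_def)
    show ?thesis unfolding B' using rootB powr_ge_zero[of "real (card B)" "4 / 5"] by linarith
  qed
  then have "root (2 * h) (add_energy h B') ^ (2 * h) \<le> (5 * real (card B') powr (4 / 5)) ^ (2 * h)"
    by (rule power_mono) (rule real_root_ge_zero, simp)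
  moreover have "root (2 * h) (add_energy h B') ^ (2 * h) = real (add_energy h B')"
    using h by (intro real_root_pow_pos2) auto
  ultimately have "real (add_energy h B') \<le> 5 ^ (2 * h) * (real (card B') powr (4 / 5)) ^ (2 * h)"
    by (simp only: power_mult_distrib)
  also have "(real (card B') powr (4 / 5)) ^ (2 * h) = real (card B') powr (4 / 5 * (2 * real h))"
    using h by (cases "B' = {}") (simp_all add: powr_power finB')
  finally have "real (add_energy h B') \<le> 5 ^ (2 * h) * real (card B') powr (4 / 5 * (2 * real h))" .
  moreover have "B' \<inter> C = {}" "A = B' \<union> C" using BC(1,2) by (auto simp: B'_def)
  ultimately show ?thesis using BC(3) by blast
qed

text \<open>L is at least 2 to the power 600 q k \<open>Lam q\<close>, and this exponent exceeds 500
  + q k. Hence L is at least 2^500 q k, which dominates both \<open>20 * k * loss_exp\<close> and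
  \<open>20 * k * depth_exp (q div 2)\<close>.\<close>

lemma s_param_exponent:
  assumes k: "1 \<le> k" and q: "even q" "2 \<le> q"
  obtains L where "s_param k q = 2 ^ L" "0 < L" "k / L * loss_exp \<le> 1 / 20" "k / L * depth_exp (q div 2) \<le> 1 / 20"
proof -
  define c where "c = \<lceil>600 * real q * k * Lam q\<rceil>"
  define L where "L = nat (5 + (1 + 120 * 2 ^ nat c) * (\<lceil>ln k\<rceil> + 1))"
  \<comment> \<open>A power of two above 20 * 10^120, to absorb \<open>loss_exp\<close>, and above
    40 * 10^57, to absorb \<open>depth_exp\<close> after the crude bound ln q \<le> q.\<close>
  define D where "D = (2 :: real) ^ 500"
  have D: "20 * loss_exp \<le> D" "40 * 10 ^ 57 \<le> D" "0 \<le> D" by (simp_all add: D_def loss_exp_def)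
  have y: "2 \<le> real q * k" using mult_mono[of 2 "real q" 1 k] k q by simp
  have "6 \<le> Lam q" using q by (simp add: Lam_def)
  then have *: "600 * (real q * k) * 6 \<le> 600 * (real q * k) * Lam q"
    using y by (intro mult_left_mono) auto
  have "600 * real q * k * Lam q \<le> real (nat c)" unfolding c_def by (rule real_nat_ceiling_ge)
  then have "600 * (real q * k) * Lam q \<le> real (nat c)" by (simp only: mult.assoc)
  with * have c: "3600 * (real q * k) \<le> real (nat c)" by linarith
  have "500 + real q * k \<le> real (nat c)" using c y by linarith
  then have c500: "500 \<le> nat c" using y by linarith
  have "real q * k \<le> real (nat c - 500)" using \<open>500 + real q * k \<le> real (nat c)\<close> c500 by (simp add: of_nat_diff)
  also have "\<dots> \<le> 2 ^ (nat c - 500)" by (metis less_imp_le of_nat_le_numeral_power_cancel_iff less_exp)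
  finally have "D * (real q * k) \<le> D * 2 ^ (nat c - 500)" using D(3) by (intro mult_left_mono)
  also have "\<dots> = 2 ^ nat c" unfolding D_def power_add[symmetric] le_add_diff_inverse[OF c500] ..
  finally have pow: "D * (real q * k) \<le> 2 ^ nat c" .
  have ceil: "0 \<le> \<lceil>ln k\<rceil>" using k ln_ge_zero[of k] by linarith
  have "(2 :: int) ^ nat c * 1 \<le> (1 + 120 * 2 ^ nat c) * (\<lceil>ln k\<rceil> + 1)"
    using ceil by (intro mult_mono) auto
  moreover have "5 + (1 + 120 * 2 ^ nat c) * (\<lceil>ln k\<rceil> + 1) \<le> int L" unfolding L_def by simp
  ultimately have "(2 :: int) ^ nat c \<le> int L" by linarith
  then have "real_of_int (2 ^ nat c) \<le> real_of_int (int L)" by (simp only: of_int_le_iff)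
  then have "(2 :: real) ^ nat c \<le> real L" by simp
  then have L: "D * (real q * k) \<le> real L" using pow by linarith
  have "0 < (2 :: real) ^ nat c" by simp
  then have L_pos: "0 < L" using \<open>2 ^ nat c \<le> real L\<close> by linarith
  have qk: "k \<le> real q * k" using k q by (simp add: mult_le_cancel_right1)
  have h: "real q = 2 * real (q div 2)" using q by auto
  have "20 * loss_exp * k \<le> D * (real q * k)"
    using D k qk by (intro mult_mono) auto
  then have 1: "20 * (k * loss_exp) \<le> real L" using L by (simp add: mult_ac)
  have "depth_exp (q div 2) \<le> 2 * real q * 10 ^ 57"
  proof -
    have "depth_exp (q div 2) = 2 * ln (real q) * 10 ^ 57" by (simp add: depth_exp_def step_size_def flip: h)
    also have "\<dots> \<le> 2 * real q * 10 ^ 57" using ln_bound[of "real q"] q by simp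
    finally show ?thesis .
  qed
  then have "20 * k * depth_exp (q div 2) \<le> 20 * k * (2 * real q * 10 ^ 57)"
    using k by (intro mult_left_mono) auto
  also have "\<dots> = 40 * 10 ^ 57 * (real q * k)" by simp
  also have "\<dots> \<le> D * (real q * k)" using D(2) y by (intro mult_right_mono) auto
  finally have 2: "20 * (k * depth_exp (q div 2)) \<le> real L" using L by linarith
  show ?thesis
  proof (rule that)
    show "s_param k q = 2 ^ L" by (simp add: s_param_def L_def c_def)
    show "0 < L" by (rule L_pos)
    show "k / L * loss_exp \<le> 1 / 20" "k / L * depth_exp (q div 2) \<le> 1 / 20"
      using 1 2 L_pos by (simp_all add: divide_simps)
  qed
qed

theorem theorem1p2:
  "\<exists>Cs :: nat \<Rightarrow> real. (\<forall>n. Cs n > 0) \<and>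
    (\<forall>(k::real) (q::nat). k \<ge> 1 \<longrightarrow> even q \<longrightarrow> q \<ge> 2 \<longrightarrow>
      (\<exists>Ckq :: real. Ckq > 0 \<and>
        (\<forall>A :: int set. finite A \<longrightarrow> A \<noteq> {} \<longrightarrow>
          (\<exists>B C. B \<inter> C = {} \<and> A = B \<union> C \<and>
             real (add_energy (q div 2) B) \<le> Ckq * real (card B) powr (real q - real q / 5) \<and>
             real (mult_energy (s_param k q) C)
               \<le> Cs (s_param k q) * real (card C) powr (2 * real (s_param k q) - k)))))"
proof (intro exI[of _ "\<lambda>_. 1"] conjI allI impI)
  fix k :: real and q :: nat
  assume kq: "1 \<le> k" "even q" "2 \<le> q"
  obtain L where L: "s_param k q = 2 ^ L" "0 < L" "k / L * loss_exp \<le> 1 / 20" "k / L * depth_exp (q div 2) \<le> 1 / 20"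
    using s_param_exponent[OF kq] .
  have h: "0 < q div 2" "real (q div 2) * 2 = real q" using kq by auto
  \<comment> \<open>The multiplicative constant is 1 because the removal stops exactly when that
    bound holds; 5^q is the q-th power of the factor in the norm bound for B.\<close>
  have "\<exists>B C. B \<inter> C = {} \<and> A = B \<union> C \<and>
       real (add_energy (q div 2) B) \<le> 5 ^ q * real (card B) powr (real q - real q / 5) \<and>
       real (mult_energy (s_param k q) C) \<le> 1 * real (card C) powr (2 * real (s_param k q) - k)"
    if "finite A" for A :: "int set"
  proof -
    have eq: "4 / 5 * (2 * real (q div 2)) = real q - real q / 5" "2 * (q div 2) = q"
      "2 * real (2 ^ L) = 2 * 2 ^ L"
      using h(2) kq by auto
    have "0 \<le> k" using kq by simp
    from add_energy_decomposition_with_zero[OF h(1) L(2) this L(3,4) that]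
    show ?thesis unfolding L(1) eq mult_1 .
  qed
  then show "\<exists>Ckq>0. \<forall>A :: int set. finite A \<longrightarrow> A \<noteq> {} \<longrightarrow>
      (\<exists>B C. B \<inter> C = {} \<and> A = B \<union> C \<and>
         real (add_energy (q div 2) B) \<le> Ckq * real (card B) powr (real q - real q / 5) \<and>
         real (mult_energy (s_param k q) C) \<le> 1 * real (card C) powr (2 * real (s_param k q) - k))"
    by (intro exI[of _ "5 ^ q"]) simp
qed simp

end
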